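(* Let $Q$ be the equioriented quiver $1\to2\to\cdots\to n$ of type $A_n$, let $M=(V_1\xrightarrow{f_1}V_2\xrightarrow{f_2}\cdots\xrightarrow{f_{n-1}}V_n)$ be any finite-dimensional complex representation of $Q$, and let $\mathbf{e}=(e_1,\dots,e_n)\in\mathbb{Z}_{\ge0}^n$. Let $T=\mathbb{C}^*$ act on $\mathrm{Gr}_{\mathbf{e}}(M)$ through a numbered standard basis of $M$ as described in the context. Then for every $T$-fixed point $L\in\mathrm{Gr}_{\mathbf{e}}(M)^T$, the attracting set $$\mathcal{C}(L)=\{N\in\mathrm{Gr}_{\mathbf{e}}(M)\;:\;\lim_{\lambda\to0}\lambda\cdot N=L\}$$ is an affine space, and the quiver Grassmannian admits the cellular decomposition $$\mathrm{Gr}_{\mathbf{e}}(M)=\coprod_{L\in\mathrm{Gr}_{\mathbf{e}}(M)^T}\mathcal{C}(L).$$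
   Context: $\mathrm{Gr}_{\mathbf{e}}(M)=\{(U_1,\dots,U_n)\in\prod_{i=1}^n\mathrm{Gr}_{e_i}(V_i): f_i(U_i)\subseteq U_{i+1}\ \text{for all } i<n\}$ is the quiver Grassmannian. Standard basis and numbering: fix bases $\mathcal{B}_i$ of $V_i$ ($i=1,\dots,n$) adapted to a decomposition of $M$ into indecomposables, such that each $f_i$ sends a basis vector of $\mathcal{B}_i$ either to $0$ or to a basis vector of $\mathcal{B}_{i+1}$. The basis vectors are labelled $v_k^{(i)}\in\mathcal{B}_i$ with positive integer indices $k$ (at each vertex $i$ only some indices $k$ occur) so that: (1) if $f_i(v_k^{(i)})\ne0$ then $f_i(v_k^{(i)})=v_k^{(i+1)}$, and the vectors with a given index $k$ form one segment, i.e. the basis of one indecomposable direct summand of $M$; (2) if $v_k^{(i)}\in\ker f_i$, then $v_j^{(i)}\in\ker f_i$ for all $j>k$ for which $v_j^{(i)}$ exists. Such a numbering always exists. Torus action: $\lambda\in T=\mathbb{C}^*$ acts on $M$ linearly by $\lambda\cdot v_k^{(i)}=\lambda^k v_k^{(i)}$; this is by automorphisms of $M$ and hence induces an action of $T$ on $\mathrm{Gr}_{\mathbf{e}}(M)$. The fixed point set $\mathrm{Gr}_{\mathbf{e}}(M)^T$ is finite and consists of the subrepresentations of dimension vector $\mathbf{e}$ spanned by standard basis vectors. *)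

theory Defs
  imports "HOL-Analysis.Analysis"
begin

section \<open>Quasi-affine varieties and isomorphisms\<close>

text \<open>
  Points of a complex affine space are functions \<open>'x \<Rightarrow> complex\<close>, and \<open>polyfun\<close> consists of the
  polynomial functions in finitely many of the coordinates.
\<close>

inductive_set polyfun :: "(('x \<Rightarrow> complex) \<Rightarrow> complex) set" where
  const: "(\<lambda>x. c) \<in> polyfun"
| coord: "(\<lambda>x. x j) \<in> polyfun"
| add: "p \<in> polyfun \<Longrightarrow> q \<in> polyfun \<Longrightarrow> (\<lambda>x. p x + q x) \<in> polyfun"
| mult: "p \<in> polyfun \<Longrightarrow> q \<in> polyfun \<Longrightarrow> (\<lambda>x. p x * q x) \<in> polyfun"

definition zariski :: "('x \<Rightarrow> complex) set \<Rightarrow> ('x \<Rightarrow> complex) topology" where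
  "zariski Y = topology (\<lambda>W. \<exists>F\<subseteq>polyfun. W = {x\<in>Y. \<exists>p\<in>F. p x \<noteq> 0})"

lemma openin_zariski:
  "openin (zariski Y) W \<longleftrightarrow> (\<exists>F\<subseteq>polyfun. W = {x\<in>Y. \<exists>p\<in>F. p x \<noteq> 0})"
proof -
  let ?P = "\<lambda>W. \<exists>F\<subseteq>polyfun. W = {x\<in>Y. \<exists>p\<in>F. p x \<noteq> 0}"
  have "istopology ?P"
    unfolding istopology_def
  proof (intro conjI allI impI)
    fix S T assume "?P S" "?P T"
    then obtain F G where FG: "F \<subseteq> polyfun" "G \<subseteq> polyfun"
      "S = {x\<in>Y. \<exists>p\<in>F. p x \<noteq> 0}" "T = {x\<in>Y. \<exists>p\<in>G. p x \<noteq> 0}" by blast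
    let ?H = "{(\<lambda>x. p x * q x) | p q. p \<in> F \<and> q \<in> G}"
    have "?H \<subseteq> polyfun" using FG by (auto intro: polyfun.mult)
    moreover have "S \<inter> T = {x\<in>Y. \<exists>p\<in>?H. p x \<noteq> 0}"
      unfolding FG(3,4) by fastforce
    ultimately show "?P (S \<inter> T)" by blast
  next
    fix \<K> assume *: "\<forall>S\<in>\<K>. ?P S"
    let ?F = "{p \<in> polyfun. {x\<in>Y. p x \<noteq> 0} \<subseteq> \<Union>\<K>}"
    have "x \<in> {x\<in>Y. \<exists>p\<in>?F. p x \<noteq> 0}" if "x \<in> S" "S \<in> \<K>" for x S
    proof -
      from * that(2) obtain F where F: "F \<subseteq> polyfun" "S = {x\<in>Y. \<exists>p\<in>F. p x \<noteq> 0}" by blast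
      with that(1) obtain p where p: "x \<in> Y" "p \<in> F" "p x \<noteq> 0" by blast
      have "{x\<in>Y. p x \<noteq> 0} \<subseteq> S" unfolding F(2) using p(2) by blast
      then have "p \<in> ?F" using F(1) p(2) that(2) by blast
      with p show ?thesis by blast
    qed
    then have "\<Union>\<K> = {x\<in>Y. \<exists>p\<in>?F. p x \<noteq> 0}" by blast
    then show "?P (\<Union>\<K>)" by (intro exI[of _ ?F]) blast
  qed
  then show ?thesis by (simp add: zariski_def)
qed

definition regular_on :: "('x \<Rightarrow> complex) set \<Rightarrow> (('x \<Rightarrow> complex) \<Rightarrow> complex) \<Rightarrow> bool" where
  "regular_on W h \<longleftrightarrow>
     (\<forall>x\<in>W. \<exists>U p q. openin (zariski W) U \<and> x \<in> U \<and> p \<in> polyfun \<and> q \<in> polyfun \<and>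
        (\<forall>y\<in>U. q y \<noteq> 0 \<and> h y = p y / q y))"

definition affine_space :: "nat \<Rightarrow> (nat \<Rightarrow> complex) set" where
  "affine_space d = {x. \<forall>j\<ge>d. x j = 0}"

text \<open>
  A variety is given by its Zariski topology and a predicate \<open>R W h\<close> saying that \<open>h\<close> is a regular
  function on the open set \<open>W\<close>.  An isomorphism is a homeomorphism \<open>\<phi>\<close> such that \<open>\<phi>\<close> and its inverse
  pull regular functions on open sets back to regular functions.
\<close>

definition variety_iso ::
  "'a topology \<Rightarrow> ('a set \<Rightarrow> ('a \<Rightarrow> complex) \<Rightarrow> bool) \<Rightarrow>
   'b topology \<Rightarrow> ('b set \<Rightarrow> ('b \<Rightarrow> complex) \<Rightarrow> bool) \<Rightarrow> ('a \<Rightarrow> 'b) \<Rightarrow> bool" where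
  "variety_iso X R Y R' \<phi> \<longleftrightarrow>
     homeomorphic_map X Y \<phi> \<and>
     (\<forall>W h. openin Y W \<longrightarrow> (R' W h \<longleftrightarrow> R {x \<in> topspace X. \<phi> x \<in> W} (h \<circ> \<phi>)))"

definition quotient_topology :: "'a topology \<Rightarrow> ('a \<Rightarrow> 'b) \<Rightarrow> 'b set \<Rightarrow> 'b topology" where
  "quotient_topology X \<pi> Y = topology (\<lambda>W. W \<subseteq> Y \<and> openin X {x \<in> topspace X. \<pi> x \<in> W})"

lemma openin_quotient_topology:
  "openin (quotient_topology X \<pi> Y) W \<longleftrightarrow> W \<subseteq> Y \<and> openin X {x \<in> topspace X. \<pi> x \<in> W}"
proof -
  let ?pre = "\<lambda>W. {x \<in> topspace X. \<pi> x \<in> W}"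
  have "?pre (S \<inter> T) = ?pre S \<inter> ?pre T" for S T by blast
  moreover have "?pre (\<Union>\<K>) = \<Union>(?pre ` \<K>)" for \<K> by blast
  ultimately have "istopology (\<lambda>W. W \<subseteq> Y \<and> openin X (?pre W))"
    unfolding istopology_def by (auto intro!: openin_Union)
  then show ?thesis by (simp add: quotient_topology_def)
qed

section \<open>Representations of the equioriented quiver of type A\<close>

text \<open>
  The spaces \<open>V 1, \<dots>, V n\<close> are finite-dimensional subspaces of one arbitrary complex vector space
  with scalar multiplication \<open>sc\<close>.  This is no restriction, since finitely many spaces always embed
  into their direct sum.  Only the values of \<open>f i\<close> on \<open>V i\<close> matter.
\<close>

definition quiver_rep ::
  "(complex \<Rightarrow> 'v::ab_group_add \<Rightarrow> 'v) \<Rightarrow> nat \<Rightarrow> (nat \<Rightarrow> 'v set) \<Rightarrow> (nat \<Rightarrow> 'v \<Rightarrow> 'v) \<Rightarrow> bool" where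
  "quiver_rep sc n V f \<longleftrightarrow>
     (\<forall>i\<in>{1..n}. module.subspace sc (V i) \<and> (\<exists>B. finite B \<and> module.span sc B = V i)) \<and>
     (\<forall>i\<in>{1..<n}. f i ` V i \<subseteq> V (Suc i) \<and>
        (\<forall>x\<in>V i. \<forall>y\<in>V i. f i (x + y) = f i x + f i y) \<and>
        (\<forall>c. \<forall>x\<in>V i. f i (sc c x) = sc c (f i x)))"

text \<open>
  \<open>K i\<close> is the set of indices occurring at vertex \<open>i\<close>, and \<open>v i k\<close> is the basis vector at vertex \<open>i\<close>
  with index \<open>k\<close>.  The last but one clause says that the vectors of index \<open>k\<close> form a segment
  \<open>v a k \<mapsto> v (a+1) k \<mapsto> \<dots> \<mapsto> v b k\<close>, where \<open>b = n\<close> or \<open>f b (v b k) = 0\<close> by the clause before it;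
  they thus span a direct summand isomorphic to the indecomposable interval module on \<open>{a..b}\<close>.
\<close>

definition numbered_basis ::
  "(complex \<Rightarrow> 'v::ab_group_add \<Rightarrow> 'v) \<Rightarrow> nat \<Rightarrow> (nat \<Rightarrow> 'v set) \<Rightarrow> (nat \<Rightarrow> 'v \<Rightarrow> 'v) \<Rightarrow>
   (nat \<Rightarrow> nat set) \<Rightarrow> (nat \<Rightarrow> nat \<Rightarrow> 'v) \<Rightarrow> bool" where
  "numbered_basis sc n V f K v \<longleftrightarrow>
     (\<forall>i\<in>{1..n}. finite (K i) \<and> 0 \<notin> K i \<and> inj_on (v i) (K i) \<and>
        \<not> module.dependent sc (v i ` K i) \<and> module.span sc (v i ` K i) = V i) \<and>
     (\<forall>i\<in>{1..<n}. \<forall>k\<in>K i. f i (v i k) \<noteq> 0 \<longrightarrow> k \<in> K (Suc i) \<and> f i (v i k) = v (Suc i) k) \<and>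
     (\<forall>k\<in>(\<Union>i\<in>{1..n}. K i). \<exists>a b. {i\<in>{1..n}. k \<in> K i} = {a..b} \<and>
        (\<forall>i\<in>{a..<b}. f i (v i k) = v (Suc i) k)) \<and>
     (\<forall>i\<in>{1..<n}. \<forall>k\<in>K i. f i (v i k) = 0 \<longrightarrow> (\<forall>j\<in>K i. k < j \<longrightarrow> f i (v i j) = 0))"

section \<open>Quiver Grassmannians\<close>

definition grassmannian ::
  "(complex \<Rightarrow> 'v::ab_group_add \<Rightarrow> 'v) \<Rightarrow> nat \<Rightarrow> 'v set \<Rightarrow> 'v set set" where
  "grassmannian sc d V = {U. module.subspace sc U \<and> U \<subseteq> V \<and> vector_space.dim sc U = d}"

definition prod_grassmannian ::
  "(complex \<Rightarrow> 'v::ab_group_add \<Rightarrow> 'v) \<Rightarrow> nat \<Rightarrow> (nat \<Rightarrow> 'v set) \<Rightarrow> (nat \<Rightarrow> nat) \<Rightarrow> (nat \<Rightarrow> 'v set) set" where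
  "prod_grassmannian sc n V e = (\<Pi>\<^sub>E i\<in>{1..n}. grassmannian sc (e i) (V i))"

definition quiver_grassmannian ::
  "(complex \<Rightarrow> 'v::ab_group_add \<Rightarrow> 'v) \<Rightarrow> nat \<Rightarrow> (nat \<Rightarrow> 'v set) \<Rightarrow> (nat \<Rightarrow> 'v \<Rightarrow> 'v) \<Rightarrow> (nat \<Rightarrow> nat) \<Rightarrow>
   (nat \<Rightarrow> 'v set) set" where
  "quiver_grassmannian sc n V f e =
     {U \<in> prod_grassmannian sc n V e. \<forall>i\<in>{1..<n}. f i ` U i \<subseteq> U (Suc i)}"

text \<open>
  The product of the Grassmannians is the geometric quotient of the variety of frames, that is, of
  families of full-rank matrices \<open>A\<close>: for \<open>c < e i\<close>, column \<open>c\<close> at vertex \<open>i\<close> has the entries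
  \<open>A (i, c, k)\<close> for \<open>k \<in> K i\<close>, and it stands for the vector with these coordinates in the basis \<open>v i\<close>.
\<close>

definition frame_span ::
  "(complex \<Rightarrow> 'v::ab_group_add \<Rightarrow> 'v) \<Rightarrow> nat \<Rightarrow> (nat \<Rightarrow> nat set) \<Rightarrow> (nat \<Rightarrow> nat \<Rightarrow> 'v) \<Rightarrow> (nat \<Rightarrow> nat) \<Rightarrow>
   (nat \<times> nat \<times> nat \<Rightarrow> complex) \<Rightarrow> nat \<Rightarrow> 'v set" where
  "frame_span sc n K v e A =
     (\<lambda>i\<in>{1..n}. module.span sc ((\<lambda>c. \<Sum>k\<in>K i. sc (A (i, c, k)) (v i k)) ` {..<e i}))"

text \<open>The columns are linearly independent because their span has dimension \<open>e i\<close>.\<close>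

definition frames ::
  "(complex \<Rightarrow> 'v::ab_group_add \<Rightarrow> 'v) \<Rightarrow> nat \<Rightarrow> (nat \<Rightarrow> 'v set) \<Rightarrow> (nat \<Rightarrow> nat set) \<Rightarrow>
   (nat \<Rightarrow> nat \<Rightarrow> 'v) \<Rightarrow> (nat \<Rightarrow> nat) \<Rightarrow> (nat \<times> nat \<times> nat \<Rightarrow> complex) set" where
  "frames sc n V K v e =
     {A. (\<forall>i c k. \<not> (i \<in> {1..n} \<and> c < e i \<and> k \<in> K i) \<longrightarrow> A (i, c, k) = 0) \<and>
         frame_span sc n K v e A \<in> prod_grassmannian sc n V e}"

definition grass_zariski ::
  "(complex \<Rightarrow> 'v::ab_group_add \<Rightarrow> 'v) \<Rightarrow> nat \<Rightarrow> (nat \<Rightarrow> 'v set) \<Rightarrow> (nat \<Rightarrow> nat set) \<Rightarrow>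
   (nat \<Rightarrow> nat \<Rightarrow> 'v) \<Rightarrow> (nat \<Rightarrow> nat) \<Rightarrow> (nat \<Rightarrow> 'v set) topology" where
  "grass_zariski sc n V K v e =
     quotient_topology (zariski (frames sc n V K v e)) (frame_span sc n K v e)
       (prod_grassmannian sc n V e)"

definition grass_classical ::
  "(complex \<Rightarrow> 'v::ab_group_add \<Rightarrow> 'v) \<Rightarrow> nat \<Rightarrow> (nat \<Rightarrow> 'v set) \<Rightarrow> (nat \<Rightarrow> nat set) \<Rightarrow>
   (nat \<Rightarrow> nat \<Rightarrow> 'v) \<Rightarrow> (nat \<Rightarrow> nat) \<Rightarrow> (nat \<Rightarrow> 'v set) topology" where
  "grass_classical sc n V K v e =
     quotient_topology (top_of_set (frames sc n V K v e)) (frame_span sc n K v e)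
       (prod_grassmannian sc n V e)"

text \<open>
  For a locally closed set \<open>W\<close> with its reduced structure this is the usual notion of a regular
  function, because the quotient map from the frames has polynomial sections locally.
\<close>

definition grass_regular_on ::
  "(complex \<Rightarrow> 'v::ab_group_add \<Rightarrow> 'v) \<Rightarrow> nat \<Rightarrow> (nat \<Rightarrow> 'v set) \<Rightarrow> (nat \<Rightarrow> nat set) \<Rightarrow>
   (nat \<Rightarrow> nat \<Rightarrow> 'v) \<Rightarrow> (nat \<Rightarrow> nat) \<Rightarrow> (nat \<Rightarrow> 'v set) set \<Rightarrow> ((nat \<Rightarrow> 'v set) \<Rightarrow> complex) \<Rightarrow> bool" where
  "grass_regular_on sc n V K v e W h \<longleftrightarrow>
     regular_on {A \<in> frames sc n V K v e. frame_span sc n K v e A \<in> W}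
       (h \<circ> frame_span sc n K v e)"

text \<open>Meant for locally closed \<open>C\<close>, regarded as a reduced subvariety.\<close>

definition is_affine_cell ::
  "(complex \<Rightarrow> 'v::ab_group_add \<Rightarrow> 'v) \<Rightarrow> nat \<Rightarrow> (nat \<Rightarrow> 'v set) \<Rightarrow> (nat \<Rightarrow> nat set) \<Rightarrow>
   (nat \<Rightarrow> nat \<Rightarrow> 'v) \<Rightarrow> (nat \<Rightarrow> nat) \<Rightarrow> (nat \<Rightarrow> 'v set) set \<Rightarrow> bool" where
  "is_affine_cell sc n V K v e C \<longleftrightarrow>
     (\<exists>d \<phi>. variety_iso (zariski (affine_space d)) regular_on
        (subtopology (grass_zariski sc n V K v e) C) (grass_regular_on sc n V K v e) \<phi>)"

section \<open>The torus action\<close>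

definition torus_act_vec ::
  "(complex \<Rightarrow> 'v::ab_group_add \<Rightarrow> 'v) \<Rightarrow> (nat \<Rightarrow> nat set) \<Rightarrow> (nat \<Rightarrow> nat \<Rightarrow> 'v) \<Rightarrow>
   complex \<Rightarrow> nat \<Rightarrow> 'v \<Rightarrow> 'v" where
  "torus_act_vec sc K v t i x =
     (\<Sum>k\<in>K i. sc (t ^ k * module.representation sc (v i ` K i) x (v i k)) (v i k))"

definition torus_act ::
  "(complex \<Rightarrow> 'v::ab_group_add \<Rightarrow> 'v) \<Rightarrow> nat \<Rightarrow> (nat \<Rightarrow> nat set) \<Rightarrow> (nat \<Rightarrow> nat \<Rightarrow> 'v) \<Rightarrow>
   complex \<Rightarrow> (nat \<Rightarrow> 'v set) \<Rightarrow> nat \<Rightarrow> 'v set" where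
  "torus_act sc n K v t N = (\<lambda>i\<in>{1..n}. torus_act_vec sc K v t i ` N i)"

definition torus_fixed ::
  "(complex \<Rightarrow> 'v::ab_group_add \<Rightarrow> 'v) \<Rightarrow> nat \<Rightarrow> (nat \<Rightarrow> 'v set) \<Rightarrow> (nat \<Rightarrow> 'v \<Rightarrow> 'v) \<Rightarrow>
   (nat \<Rightarrow> nat set) \<Rightarrow> (nat \<Rightarrow> nat \<Rightarrow> 'v) \<Rightarrow> (nat \<Rightarrow> nat) \<Rightarrow> (nat \<Rightarrow> 'v set) set" where
  "torus_fixed sc n V f K v e =
     {L \<in> quiver_grassmannian sc n V f e. \<forall>t. t \<noteq> 0 \<longrightarrow> torus_act sc n K v t L = L}"

definition attracting_set ::
  "(complex \<Rightarrow> 'v::ab_group_add \<Rightarrow> 'v) \<Rightarrow> nat \<Rightarrow> (nat \<Rightarrow> 'v set) \<Rightarrow> (nat \<Rightarrow> 'v \<Rightarrow> 'v) \<Rightarrow>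
   (nat \<Rightarrow> nat set) \<Rightarrow> (nat \<Rightarrow> nat \<Rightarrow> 'v) \<Rightarrow> (nat \<Rightarrow> nat) \<Rightarrow> (nat \<Rightarrow> 'v set) \<Rightarrow> (nat \<Rightarrow> 'v set) set" where
  "attracting_set sc n V f K v e L =
     {N \<in> quiver_grassmannian sc n V f e.
        limitin (subtopology (grass_classical sc n V K v e) (quiver_grassmannian sc n V f e))
          (\<lambda>t. torus_act sc n K v t N) L (at 0)}"

section \<open>Cellular decompositions\<close>

text \<open>
  A cellular decomposition is a finite partition into affine spaces that can be ordered such that
  all initial unions are Zariski closed; in particular every part is locally closed.
\<close>

definition cellular_decomposition ::
  "(complex \<Rightarrow> 'v::ab_group_add \<Rightarrow> 'v) \<Rightarrow> nat \<Rightarrow> (nat \<Rightarrow> 'v set) \<Rightarrow> (nat \<Rightarrow> nat set) \<Rightarrow>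
   (nat \<Rightarrow> nat \<Rightarrow> 'v) \<Rightarrow> (nat \<Rightarrow> nat) \<Rightarrow> (nat \<Rightarrow> 'v set) set \<Rightarrow>
   'l set \<Rightarrow> ('l \<Rightarrow> (nat \<Rightarrow> 'v set) set) \<Rightarrow> bool" where
  "cellular_decomposition sc n V K v e X I C \<longleftrightarrow>
     X = (\<Union>l\<in>I. C l) \<and> disjoint_family_on C I \<and>
     (\<forall>l\<in>I. is_affine_cell sc n V K v e (C l)) \<and>
     (\<exists>ls. distinct ls \<and> set ls = I \<and>
        (\<forall>m\<le>length ls. closedin (subtopology (grass_zariski sc n V K v e) X)
           (\<Union>l\<in>set (take m ls). C l)))"

end

theory Submission
  imports Defs "Jordan_Normal_Form.Determinant"
begin

text \<open>
  Every subspace of a space with numbered basis is the graph of a unique matrix \<open>b\<close> in echelon form: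
  it has a basis \<open>v k + (\<Sum>l. b k l v l)\<close> for \<open>k\<close> in a set \<open>S\<close> of pivots, with \<open>b k l \<noteq> 0\<close> only for
  \<open>l > k\<close> outside \<open>S\<close>. The torus multiplies \<open>b k l\<close> by \<open>t ^ (l - k)\<close>, so the limit at \<open>0\<close> is the
  coordinate subspace of the pivots, and attracting sets are the sets of subrepresentations with given
  pivots \<open>S i\<close>. Since the kernel of \<open>f i\<close> contains the basis vectors with large index, the graphs form a
  subrepresentation iff \<open>b i k l = b (i+1) k l + (\<Sum>j. b i k j * b (i+1) j l)\<close> for all \<open>k\<close> in
  \<open>S i \<inter> S (i+1)\<close>. This determines \<open>b (i+1) k l\<close> recursively, and the remaining coefficients are free
  coordinates on the cell. By Cramer's rule they are rational functions of a frame. If a graph over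
  \<open>S\<close> has pivots \<open>S'\<close>, then the largest index at which \<open>S\<close> and \<open>S'\<close> differ belongs to \<open>S\<close>; hence ordering
  the cells by decreasing \<open>\<Sum>k\<in>S. 2 ^ k\<close> makes all initial unions closed.
\<close>

section \<open>Rational functions\<close>

text \<open>A quiver Grassmannian can be singular, so the theorem of Bialynicki-Birula on smooth
  projective varieties does not yield affine cells; they have to be parametrized explicitly.
  Condition (2) on the numbering is what makes this possible: an echelon vector whose pivot index
  ends at a vertex has only entries that end there too, and so imposes no equation. Every other
  equation contains its unknown \<open>b (i+1) k l\<close> linearly with coefficient 1. Solving for
  it never divides, and the solution is polynomial in the free coordinates. Limits are classical
  while cells and closures are Zariski. Both topologies are quotients of frames, so both kinds of
  statement are checked on frames, by means of the same minors. The powers \<open>2 ^ k\<close> turn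
  pivot sets into binary numbers, which compare by the largest index at which two sets differ; a sum
  over the vertices keeps a strict inequality at a single vertex.\<close>

definition ratfun :: "('x \<Rightarrow> complex) set \<Rightarrow> (('x \<Rightarrow> complex) \<Rightarrow> complex) set" where
  "ratfun Y = {h. \<exists>p\<in>polyfun. \<exists>q\<in>polyfun. \<forall>y\<in>Y. q y \<noteq> 0 \<and> h y = p y / q y}"

lemma ratfunI:
  "p \<in> polyfun \<Longrightarrow> q \<in> polyfun \<Longrightarrow> (\<And>y. y \<in> Y \<Longrightarrow> q y \<noteq> 0) \<Longrightarrow> (\<And>y. y \<in> Y \<Longrightarrow> h y = p y / q y)
    \<Longrightarrow> h \<in> ratfun Y"
  unfolding ratfun_def by blast

lemma polyfun_sum: "(\<And>a. a \<in> I \<Longrightarrow> (\<lambda>x. F a x) \<in> polyfun) \<Longrightarrow> (\<lambda>x. \<Sum>a\<in>I. F a x) \<in> polyfun"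
  by (induction I rule: infinite_finite_induct) (auto intro: polyfun.intros)

lemma polyfun_prod: "(\<And>a. a \<in> I \<Longrightarrow> (\<lambda>x. F a x) \<in> polyfun) \<Longrightarrow> (\<lambda>x. \<Prod>a\<in>I. F a x) \<in> polyfun"
  by (induction I rule: infinite_finite_induct) (auto intro: polyfun.intros)

lemma polyfun_diff:
  assumes "p \<in> polyfun" "q \<in> polyfun" shows "(\<lambda>x. p x - q x) \<in> polyfun"
proof -
  have "(\<lambda>x. p x + (-1) * q x) \<in> polyfun"
    using assms by (intro polyfun.intros)
  then show ?thesis by simp
qed

lemma polyfun_ratfun: "p \<in> polyfun \<Longrightarrow> p \<in> ratfun Y"
  by (rule ratfunI[where q = "\<lambda>_. 1"]) (auto intro: polyfun.intros)

text \<open>A denominator that vanishes nowhere on \<open>Y\<close> is stable under sums and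
  products, so no local covering of \<open>Y\<close> is needed; in the application the denominators
  are the minors that define a chart.\<close>

lemma polyfun_compose_ratfun:
  assumes "p \<in> polyfun" "\<And>j. (\<lambda>y. g y j) \<in> ratfun Y"
  shows "(\<lambda>y. p (g y)) \<in> ratfun Y"
  using assms(1)
proof (induction rule: polyfun.induct)
  case (const c) then show ?case by (auto intro: polyfun_ratfun polyfun.intros)
next
  case (coord j) then show ?case by (rule assms(2))
next
  case (add p q)
  then obtain a b a' b' where *: "a \<in> polyfun" "b \<in> polyfun" "a' \<in> polyfun" "b' \<in> polyfun"
    "\<And>y. y \<in> Y \<Longrightarrow> b y \<noteq> 0 \<and> p (g y) = a y / b y" "\<And>y. y \<in> Y \<Longrightarrow> b' y \<noteq> 0 \<and> q (g y) = a' y / b' y"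
    unfolding ratfun_def by blast
  show ?case
    by (rule ratfunI[where p = "\<lambda>x. a x * b' x + a' x * b x" and q = "\<lambda>x. b x * b' x"])
       (use * in \<open>auto intro!: polyfun.intros simp: field_simps\<close>)
next
  case (mult p q)
  then obtain a b a' b' where *: "a \<in> polyfun" "b \<in> polyfun" "a' \<in> polyfun" "b' \<in> polyfun"
    "\<And>y. y \<in> Y \<Longrightarrow> b y \<noteq> 0 \<and> p (g y) = a y / b y" "\<And>y. y \<in> Y \<Longrightarrow> b' y \<noteq> 0 \<and> q (g y) = a' y / b' y"
    unfolding ratfun_def by blast
  show ?case
    by (rule ratfunI[where p = "\<lambda>x. a x * a' x" and q = "\<lambda>x. b x * b' x"])
       (use * in \<open>auto intro!: polyfun.intros\<close>)
qed

lemma continuous_on_polyfun: "p \<in> polyfun \<Longrightarrow> continuous_on UNIV p"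
  by (induction rule: polyfun.induct)
     (auto intro: continuous_intros continuous_on_product_coordinates)

section \<open>Zariski topology and regular functions under rational maps\<close>

lemma topspace_zariski [simp]: "topspace (zariski Y) = Y"
proof -
  have "openin (zariski Y) Y"
    unfolding openin_zariski
    by (rule exI[of _ "{\<lambda>_. 1}"]) (auto intro: polyfun.intros)
  moreover have "W \<subseteq> Y" if "openin (zariski Y) W" for W
    using that unfolding openin_zariski by auto
  ultimately show ?thesis
    by (meson openin_topspace openin_subset subset_antisym)
qed

lemma openin_zariski_nonzero: "q \<in> polyfun \<Longrightarrow> openin (zariski Y) {x \<in> Y. q x \<noteq> 0}"
  unfolding openin_zariski by (rule exI[of _ "{q}"]) auto

text \<open>If \<open>p (g y) = a y / b y\<close> with \<open>b\<close> nowhere zero on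
  \<open>Y\<close>, then it vanishes exactly where \<open>a\<close> does; the numerators therefore
  define the preimage.\<close>

lemma openin_zariski_preimage:
  assumes g: "\<And>j. (\<lambda>y. g y j) \<in> ratfun Y" and gYZ: "g ` Y \<subseteq> Z" and W: "openin (zariski Z) W"
  shows "openin (zariski Y) {y \<in> Y. g y \<in> W}"
proof -
  obtain F where F: "F \<subseteq> polyfun" "W = {x\<in>Z. \<exists>p\<in>F. p x \<noteq> 0}"
    using W unfolding openin_zariski by blast
  let ?G = "{a \<in> polyfun. \<exists>p\<in>F. \<exists>b\<in>polyfun. \<forall>y\<in>Y. b y \<noteq> 0 \<and> p (g y) = a y / b y}"
  have "{y \<in> Y. g y \<in> W} = {y\<in>Y. \<exists>a\<in>?G. a y \<noteq> 0}"
  proof (intro equalityI subsetI)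
    fix y assume "y \<in> {y \<in> Y. g y \<in> W}"
    then obtain p where p: "y \<in> Y" "p \<in> F" "p (g y) \<noteq> 0" using F by auto
    have "(\<lambda>y. p (g y)) \<in> ratfun Y" using p F g by (blast intro: polyfun_compose_ratfun)
    then obtain a b where "a \<in> polyfun" "b \<in> polyfun" "\<forall>y\<in>Y. b y \<noteq> 0 \<and> p (g y) = a y / b y"
      unfolding ratfun_def by blast
    note ab = this
    have "a \<in> ?G" using ab p(2) by blast
    moreover have "a y \<noteq> 0" using ab(3) p(1,3) by auto
    ultimately show "y \<in> {y\<in>Y. \<exists>a\<in>?G. a y \<noteq> 0}" using p(1) by blast
  next
    fix y assume "y \<in> {y\<in>Y. \<exists>a\<in>?G. a y \<noteq> 0}"
    then obtain a p b where a: "y \<in> Y" "a y \<noteq> 0" "p \<in> F" "\<forall>y\<in>Y. b y \<noteq> 0 \<and> p (g y) = a y / b y"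
      by blast
    then have "p (g y) \<noteq> 0" by auto
    then show "y \<in> {y \<in> Y. g y \<in> W}" using a F gYZ by blast
  qed
  moreover have "?G \<subseteq> polyfun" by blast
  ultimately show ?thesis unfolding openin_zariski by blast
qed

lemma regular_on_cong:
  assumes "\<And>x. x \<in> W \<Longrightarrow> h x = h' x" shows "regular_on W h \<longleftrightarrow> regular_on W h'"
proof -
  have "y \<in> W" if "openin (zariski W) U" "y \<in> U" for U y
    using openin_subset[OF that(1)] that(2) by auto
  with assms show ?thesis unfolding regular_on_def by (metis (no_types, lifting))
qed

lemma regular_on_compose:
  assumes g: "\<And>j. (\<lambda>y. g y j) \<in> ratfun Y" and gYZ: "g ` Y \<subseteq> Z" and h: "regular_on Z h"
  shows "regular_on Y (\<lambda>y. h (g y))"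
  unfolding regular_on_def
proof
  fix y assume y: "y \<in> Y"
  then have "g y \<in> Z" using gYZ by blast
  with h obtain U p q where U: "openin (zariski Z) U" "g y \<in> U" "p \<in> polyfun" "q \<in> polyfun"
     and pq: "\<forall>z\<in>U. q z \<noteq> 0 \<and> h z = p z / q z"
    unfolding regular_on_def by meson
  obtain a b where ab: "a \<in> polyfun" "b \<in> polyfun" "\<forall>y\<in>Y. b y \<noteq> 0 \<and> p (g y) = a y / b y"
    using polyfun_compose_ratfun[where g = g, OF U(3) g] unfolding ratfun_def by blast
  obtain c d where cd: "c \<in> polyfun" "d \<in> polyfun" "\<forall>y\<in>Y. d y \<noteq> 0 \<and> q (g y) = c y / d y"
    using polyfun_compose_ratfun[where g = g, OF U(4) g] unfolding ratfun_def by blast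
  let ?U = "{y \<in> Y. g y \<in> U}"
  have "openin (zariski Y) ?U" using g gYZ U(1) by (rule openin_zariski_preimage)
  \<comment> \<open>The factor \<open>c\<close> is nonzero on \<open>?U\<close> because
    \<open>q (g y) = c y / d y\<close> is nonzero there.\<close>
  moreover have "\<forall>y\<in>?U. b y * c y \<noteq> 0 \<and> h (g y) = a y * d y / (b y * c y)"
    using pq ab cd by (auto simp: field_simps)
  ultimately show "\<exists>U p q. openin (zariski Y) U \<and> y \<in> U \<and> p \<in> polyfun \<and> q \<in> polyfun \<and>
        (\<forall>y\<in>U. q y \<noteq> 0 \<and> h (g y) = p y / q y)"
    using y U(2) ab cd
    by (intro exI[of _ ?U] exI[of _ "\<lambda>y. a y * d y"] exI[of _ "\<lambda>y. b y * c y"])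
       (auto intro!: polyfun.intros)
qed

text \<open>
  The retraction \<open>\<rho>\<close> is needed on a saturated open neighbourhood of the preimage of \<open>C\<close>: the subspace
  topology on \<open>C\<close> comes from open sets of the whole quotient.
\<close>

lemma variety_iso_quotientI:
  fixes F :: "('x \<Rightarrow> complex) set" and \<pi> :: "('x \<Rightarrow> complex) \<Rightarrow> 'p" and Y U C :: "'p set"
  defines "Q \<equiv> quotient_topology (zariski F) \<pi> Y"
  assumes U: "openin Q U" and CU: "C \<subseteq> U"
    and surj: "\<And>N. N \<in> U \<Longrightarrow> \<exists>A\<in>F. \<pi> A = N"
    and \<psi>: "\<And>j. (\<lambda>x. \<psi> x j) \<in> polyfun"
    and \<psi>F: "\<And>x. x \<in> affine_space d \<Longrightarrow> \<psi> x \<in> F \<and> \<pi> (\<psi> x) \<in> C"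
    and \<rho>: "\<And>j. (\<lambda>A. \<rho> A j) \<in> ratfun {A \<in> F. \<pi> A \<in> U}"
    and \<rho>aff: "\<And>A. A \<in> F \<Longrightarrow> \<pi> A \<in> U \<Longrightarrow> \<rho> A \<in> affine_space d"
    and \<rho>inv: "\<And>A A'. A \<in> F \<Longrightarrow> A' \<in> F \<Longrightarrow> \<pi> A \<in> U \<Longrightarrow> \<pi> A = \<pi> A' \<Longrightarrow> \<rho> A = \<rho> A'"
    and \<rho>\<psi>: "\<And>x. x \<in> affine_space d \<Longrightarrow> \<rho> (\<psi> x) = x"
    and \<psi>\<rho>: "\<And>A. A \<in> F \<Longrightarrow> \<pi> A \<in> C \<Longrightarrow> \<pi> (\<psi> (\<rho> A)) = \<pi> A"
  shows "variety_iso (zariski (affine_space d)) regular_on (subtopology Q C)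
     (\<lambda>W h. regular_on {A \<in> F. \<pi> A \<in> W} (h \<circ> \<pi>)) (\<pi> \<circ> \<psi>)"
proof -
  let ?A = "affine_space d"
  have opQ: "openin Q W \<longleftrightarrow> W \<subseteq> Y \<and> openin (zariski F) {A\<in>F. \<pi> A \<in> W}" for W
    unfolding Q_def openin_quotient_topology by simp
  have UY: "U \<subseteq> Y" using U opQ by auto
  have topC: "topspace (subtopology Q C) = C"
    using openin_subset[OF U] CU by (auto simp: topspace_subtopology)
  have \<psi>r: "(\<lambda>x. \<psi> x j) \<in> ratfun Z" for j Z using \<psi> by (rule polyfun_ratfun)
  \<comment> \<open>An arbitrary frame of \<open>N\<close> is chosen; for \<open>N\<close> in
    \<open>U\<close> the value of \<open>\<rho>\<close> is the same on all of them.\<close>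
  define \<sigma> where "\<sigma> N = \<rho> (SOME A. A \<in> F \<and> \<pi> A = N)" for N
  have \<sigma>: "\<sigma> (\<pi> A) = \<rho> A" if "A \<in> F" "\<pi> A \<in> U" for A
  proof -
    have "(SOME A'. A' \<in> F \<and> \<pi> A' = \<pi> A) \<in> F \<and> \<pi> (SOME A'. A' \<in> F \<and> \<pi> A' = \<pi> A) = \<pi> A"
      by (rule someI[of _ A]) (use that in auto)
    then show ?thesis unfolding \<sigma>_def using \<rho>inv that by metis
  qed
  have cont: "continuous_map (zariski ?A) (subtopology Q C) (\<pi> \<circ> \<psi>)"
    unfolding continuous_map_def topC topspace_zariski
  proof (intro conjI allI impI)
    show "\<pi> \<circ> \<psi> \<in> ?A \<rightarrow> C" using \<psi>F by auto
    fix W assume "openin (subtopology Q C) W"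
    then obtain W' where W': "openin Q W'" "W = W' \<inter> C" by (auto simp: openin_subtopology)
    have "openin (zariski ?A) {x \<in> ?A. \<psi> x \<in> {A\<in>F. \<pi> A \<in> W'}}"
      by (rule openin_zariski_preimage[where Z = F]) (use \<psi>r \<psi>F W' opQ in auto)
    also have "{x \<in> ?A. \<psi> x \<in> {A\<in>F. \<pi> A \<in> W'}} = {x \<in> ?A. (\<pi> \<circ> \<psi>) x \<in> W}"
      using \<psi>F W' by auto
    finally show "openin (zariski ?A) {x \<in> ?A. (\<pi> \<circ> \<psi>) x \<in> W}" .
  qed
  have contU: "continuous_map (subtopology Q U) (zariski ?A) \<sigma>"
    unfolding continuous_map_def topspace_zariski
  proof (intro conjI allI impI)
    have tU: "topspace (subtopology Q U) = U"
      using openin_subset[OF U] by (auto simp: topspace_subtopology)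
    show "\<sigma> \<in> topspace (subtopology Q U) \<rightarrow> ?A"
      unfolding tU using surj \<sigma> \<rho>aff by fastforce
    fix W assume W: "openin (zariski ?A) W"
    have "openin (zariski {A \<in> F. \<pi> A \<in> U}) {A \<in> {A \<in> F. \<pi> A \<in> U}. \<rho> A \<in> W}"
      by (rule openin_zariski_preimage[where g = \<rho>, OF \<rho> _ W]) (use \<rho>aff in auto)
    then obtain G where G: "G \<subseteq> polyfun"
      "{A \<in> {A \<in> F. \<pi> A \<in> U}. \<rho> A \<in> W} = {A\<in>{A \<in> F. \<pi> A \<in> U}. \<exists>p\<in>G. p A \<noteq> 0}"
      unfolding openin_zariski by blast
    \<comment> \<open>The polynomials in \<open>G\<close> are defined on all of \<open>F\<close>;
      intersecting with the preimage of \<open>U\<close>, which is open, turns the relatively open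
      set into an open set of \<open>F\<close>.\<close>
    have "openin (zariski F) ({A\<in>F. \<pi> A \<in> U} \<inter> {A\<in>F. \<exists>p\<in>G. p A \<noteq> 0})"
      using U opQ G(1) by (intro openin_Int) (auto simp: openin_zariski)
    also have "\<dots> = {A \<in> {A \<in> F. \<pi> A \<in> U}. \<rho> A \<in> W}"
      unfolding G(2) by auto
    also have "\<dots> = {A \<in> F. \<pi> A \<in> {N \<in> U. \<sigma> N \<in> W}}" using \<sigma> by auto
    finally have "openin Q {N \<in> U. \<sigma> N \<in> W}" using opQ UY by auto
    then show "openin (subtopology Q U) {x \<in> topspace (subtopology Q U). \<sigma> x \<in> W}"
      unfolding tU by (auto simp: openin_subtopology intro!: exI[of _ "{N \<in> U. \<sigma> N \<in> W}"])
  qed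
  have contC: "continuous_map (subtopology Q C) (zariski ?A) \<sigma>"
    using continuous_map_from_subtopology[OF contU, of C] CU
    by (simp add: subtopology_subtopology inf.absorb2)
  have inv1: "\<sigma> ((\<pi> \<circ> \<psi>) x) = x" if "x \<in> ?A" for x
    using \<sigma>[of "\<psi> x"] \<psi>F[OF that] CU \<rho>\<psi>[OF that] by auto
  have inv2: "(\<pi> \<circ> \<psi>) (\<sigma> N) = N" if "N \<in> C" for N
    using surj[of N] \<sigma> that CU \<psi>\<rho> by fastforce
  have homeo: "homeomorphic_map (zariski ?A) (subtopology Q C) (\<pi> \<circ> \<psi>)"
    by (rule homeomorphic_maps_map[THEN iffD1, THEN conjunct1, of _ _ _ \<sigma>])
       (auto simp: homeomorphic_maps_def topC cont contC inv1[simplified] inv2[simplified])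
  show ?thesis
    unfolding variety_iso_def
  proof (intro conjI allI impI homeo)
    fix W h assume "openin (subtopology Q C) W"
    then have WC: "W \<subseteq> C" using openin_subset topC by blast
    let ?X = "{x \<in> topspace (zariski ?A). (\<pi> \<circ> \<psi>) x \<in> W}" and ?F = "{A \<in> F. \<pi> A \<in> W}"
    show "regular_on ?F (h \<circ> \<pi>) \<longleftrightarrow> regular_on ?X (h \<circ> (\<pi> \<circ> \<psi>))"
    proof
      assume "regular_on ?F (h \<circ> \<pi>)"
      from regular_on_compose[OF _ _ this, of \<psi> ?X] show "regular_on ?X (h \<circ> (\<pi> \<circ> \<psi>))"
        using \<psi>r \<psi>F by (auto simp: o_def)
    next
      assume *: "regular_on ?X (h \<circ> (\<pi> \<circ> \<psi>))"
      have "(\<lambda>A. \<rho> A j) \<in> ratfun ?F" for j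
        using \<rho>[of j] WC CU unfolding ratfun_def by blast
      from regular_on_compose[OF this _ *] have "regular_on ?F (\<lambda>A. (h \<circ> (\<pi> \<circ> \<psi>)) (\<rho> A))"
        using WC CU \<rho>aff \<psi>\<rho> by force
      \<comment> \<open>Over \<open>C\<close> the composite of \<open>\<rho>\<close>,
        \<open>\<psi>\<close> and \<open>\<pi>\<close> is \<open>\<pi>\<close> itself, so on
        \<open>?F\<close> the function just shown to be regular is the required one.\<close>
      then show "regular_on ?F (h \<circ> \<pi>)"
        by (subst regular_on_cong[where h' = "\<lambda>A. (h \<circ> (\<pi> \<circ> \<psi>)) (\<rho> A)"]) (use WC \<psi>\<rho> in auto)
    qed
  qed
qed

section \<open>Cramer's rule\<close>

definition det_fun :: "nat \<Rightarrow> (nat \<Rightarrow> nat \<Rightarrow> complex) \<Rightarrow> complex" where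
  "det_fun d M = Determinant.det (Matrix.mat d d (\<lambda>(r, c). M r c))"

lemma mat_mult_vec_fun:
  "Matrix.mat d d (\<lambda>(r, c). M r c) *\<^sub>v Matrix.vec d y = Matrix.vec d (\<lambda>r. \<Sum>c<d. M r c * y c)"
  by (intro eq_vecI) (auto simp: scalar_prod_def lessThan_atLeast0)

lemma det_fun_eq_0_iff:
  "det_fun d M = 0 \<longleftrightarrow> (\<exists>y. (\<exists>c<d. y c \<noteq> 0) \<and> (\<forall>r<d. (\<Sum>c<d. M r c * y c) = 0))"
proof -
  let ?M = "Matrix.mat d d (\<lambda>(r, c). M r c)"
  have "det_fun d M = 0 \<longleftrightarrow> (\<exists>w. w \<in> carrier_vec d \<and> w \<noteq> 0\<^sub>v d \<and> ?M *\<^sub>v w = 0\<^sub>v d)"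
    unfolding det_fun_def by (rule det_0_iff_vec_prod_zero_field) simp
  also have "\<dots> \<longleftrightarrow> (\<exists>y. Matrix.vec d y \<noteq> 0\<^sub>v d \<and> ?M *\<^sub>v Matrix.vec d y = 0\<^sub>v d)"
    by (metis dim_vec carrier_vecD eq_vecI index_vec vec_carrier)
  also have "\<dots> \<longleftrightarrow> (\<exists>y. (\<exists>c<d. y c \<noteq> 0) \<and> (\<forall>r<d. (\<Sum>c<d. M r c * y c) = 0))"
    unfolding mat_mult_vec_fun by (auto simp: vec_eq_iff)
  finally show ?thesis .
qed

lemma det_fun_cramer:
  assumes "\<And>r. r < d \<Longrightarrow> (\<Sum>c<d. M r c * y c) = u r" "c < d"
  shows "y c * det_fun d M = det_fun d (\<lambda>r j. if j = c then u r else M r j)"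
proof -
  let ?M = "Matrix.mat d d (\<lambda>(r, c). M r c)"
  have "Determinant.det (replace_col ?M (?M *\<^sub>v Matrix.vec d y) c) = Matrix.vec d y $ c * Determinant.det ?M"
    by (rule cramer_lemma_mat) (use assms in auto)
  moreover have "replace_col ?M (?M *\<^sub>v Matrix.vec d y) c
      = Matrix.mat d d (\<lambda>(r, j). if j = c then u r else M r j)"
    unfolding mat_mult_vec_fun replace_col_def
    by (intro eq_matI) (use assms in auto)
  ultimately show ?thesis using assms unfolding det_fun_def by simp
qed

lemma det_fun_solve:
  assumes "det_fun d M \<noteq> 0"
  shows "\<exists>y. \<forall>r<d. (\<Sum>c<d. M r c * y c) = u r"
proof -
  let ?M = "Matrix.mat d d (\<lambda>(r, c). M r c)"
  have "?M \<in> Units (ring_mat TYPE(complex) d ())"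
    using assms unfolding det_fun_def by (intro det_non_zero_imp_unit) auto
  then obtain B where B: "B \<in> carrier_mat d d" "?M * B = 1\<^sub>m d"
    unfolding Units_def ring_mat_def by auto
  let ?w = "B *\<^sub>v Matrix.vec d u"
  have w: "?w = Matrix.vec d (\<lambda>c. ?w $ c)" using B by (intro eq_vecI) auto
  have "?M *\<^sub>v ?w = (?M * B) *\<^sub>v Matrix.vec d u"
    using B by (intro assoc_mult_mat_vec[symmetric]) auto
  then have "?M *\<^sub>v ?w = Matrix.vec d u" using B by simp
  then have "Matrix.vec d (\<lambda>r. \<Sum>c<d. M r c * ?w $ c) = Matrix.vec d u"
    using w mat_mult_vec_fun by metis
  then have "\<forall>r<d. (\<Sum>c<d. M r c * ?w $ c) = u r" by (simp add: vec_eq_iff)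
  then show ?thesis by blast
qed

text \<open>The Leibniz expansion is a finite sum of products of entries.\<close>

lemma polyfun_det_fun:
  assumes "\<And>r c. r < d \<Longrightarrow> c < d \<Longrightarrow> (\<lambda>x. M x r c) \<in> polyfun"
  shows "(\<lambda>x. det_fun d (M x)) \<in> polyfun"
proof -
  have "det_fun d (M x) = (\<Sum>p | p permutes {0..<d}. of_int (sign p) * (\<Prod>i = 0..<d. M x i (p i)))" for x
    unfolding det_fun_def by (subst det_def'[of _ d]) (auto intro!: sum.cong prod.cong simp: permutes_in_image)
  then show ?thesis using assms
    by (auto intro!: polyfun_sum polyfun.intros polyfun_prod simp: permutes_in_image)
qed

section \<open>Coordinates and graphs in a space with a numbered basis\<close>

locale numbered_space = vector_space sc
  for sc :: "complex \<Rightarrow> 'v::ab_group_add \<Rightarrow> 'v" +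
  fixes K :: "nat set" and v :: "nat \<Rightarrow> 'v"
  assumes finite_K: "finite K" and inj_v: "inj_on v K" and independent_v: "independent (v ` K)"
begin

definition coord :: "'v \<Rightarrow> nat \<Rightarrow> complex" where
  "coord x k = representation (v ` K) x (v k)"

definition comb :: "(nat \<Rightarrow> complex) \<Rightarrow> 'v" where
  "comb a = (\<Sum>k\<in>K. sc (a k) (v k))"

abbreviation total :: "'v set" where "total \<equiv> span (v ` K)"

definition graph :: "nat set \<Rightarrow> (nat \<Rightarrow> nat \<Rightarrow> complex) \<Rightarrow> 'v set" where
  "graph S b = {x \<in> total. \<forall>l\<in>K - S. coord x l = (\<Sum>k\<in>S. coord x k * b k l)}"

definition graph_vec :: "nat set \<Rightarrow> (nat \<Rightarrow> nat \<Rightarrow> complex) \<Rightarrow> nat \<Rightarrow> 'v" where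
  "graph_vec S b k = comb (\<lambda>l. if l \<in> S then (if l = k then 1 else 0) else b k l)"

text \<open>Injectivity of the projection of the subspace \<open>U\<close> to the coordinates in
  \<open>S\<close>. In dimension \<open>card S\<close> this is the standard affine chart of the
  Grassmannian, where the Pluecker coordinate of \<open>S\<close> does not vanish.\<close>

definition in_chart :: "nat set \<Rightarrow> 'v set \<Rightarrow> bool" where
  "in_chart S U \<longleftrightarrow> (\<forall>x\<in>U. (\<forall>k\<in>S. coord x k = 0) \<longrightarrow> x = 0)"

lemma coord_add: "x \<in> total \<Longrightarrow> y \<in> total \<Longrightarrow> coord (x + y) k = coord x k + coord y k"
  unfolding coord_def by (simp add: representation_add[OF independent_v])

lemma coord_diff: "x \<in> total \<Longrightarrow> y \<in> total \<Longrightarrow> coord (x - y) k = coord x k - coord y k"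
  unfolding coord_def by (simp add: representation_diff[OF independent_v])

lemma coord_scale: "x \<in> total \<Longrightarrow> coord (sc c x) k = c * coord x k"
  unfolding coord_def by (simp add: representation_scale[OF independent_v])

lemma coord_sum: "(\<And>i. i \<in> I \<Longrightarrow> g i \<in> total) \<Longrightarrow> coord (sum g I) k = (\<Sum>i\<in>I. coord (g i) k)"
  unfolding coord_def by (simp add: representation_sum[OF independent_v])

lemma coord_zero [simp]: "coord 0 k = 0"
  unfolding coord_def by (simp add: representation_zero)

lemma v_in_total: "k \<in> K \<Longrightarrow> v k \<in> total"
  by (simp add: span_base)

lemma coord_v: "k \<in> K \<Longrightarrow> l \<in> K \<Longrightarrow> coord (v k) l = (if l = k then 1 else 0)"
  unfolding coord_def using inj_v by (auto simp: representation_basis[OF independent_v] inj_on_def)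

lemma comb_in_total [simp]: "comb a \<in> total"
  unfolding comb_def by (intro span_sum span_scale v_in_total)

lemma coord_comb: "l \<in> K \<Longrightarrow> coord (comb a) l = a l"
proof -
  assume l: "l \<in> K"
  have "coord (comb a) l = (\<Sum>k\<in>K. coord (sc (a k) (v k)) l)"
    unfolding comb_def by (intro coord_sum span_scale v_in_total)
  also have "\<dots> = (\<Sum>k\<in>K. if k = l then a k else 0)"
    using l by (intro sum.cong) (auto simp: coord_scale v_in_total coord_v)
  finally show ?thesis using l finite_K by simp
qed

lemma comb_coord: "x \<in> total \<Longrightarrow> comb (coord x) = x"
  using sum_representation_eq[OF independent_v, of x "v ` K"] finite_K
  unfolding comb_def coord_def by (simp add: sum.reindex[OF inj_v] o_def)

lemma comb_cong: "(\<And>k. k \<in> K \<Longrightarrow> a k = a' k) \<Longrightarrow> comb a = comb a'"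
  unfolding comb_def by (intro sum.cong) auto

lemma total_eqI:
  "x \<in> total \<Longrightarrow> y \<in> total \<Longrightarrow> (\<And>k. k \<in> K \<Longrightarrow> coord x k = coord y k) \<Longrightarrow> x = y"
  using comb_cong[of "coord x" "coord y"] comb_coord by metis

lemma coord_lincomb:
  "coord (\<Sum>i\<in>I. sc (c i) (comb (a i))) l = (\<Sum>i\<in>I. c i * coord (comb (a i)) l)"
  by (subst coord_sum) (auto intro: span_scale simp: coord_scale)

section \<open>Graphs of matrices and the vectors spanning them\<close>

lemma graph_subset: "graph S b \<subseteq> total"
  unfolding graph_def by auto

lemma graph_cong:
  "(\<And>k l. k \<in> S \<Longrightarrow> l \<in> K - S \<Longrightarrow> b k l = b' k l) \<Longrightarrow> graph S b = graph S b'"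
  unfolding graph_def by (auto intro!: sum.cong)

lemma subspace_graph: "subspace (graph S b)"
  unfolding subspace_def graph_def
  by (auto simp: coord_add coord_scale span_add span_scale span_zero sum.distrib sum_distrib_left
      algebra_simps)

lemma in_chart_graph: "in_chart S (graph S b)"
  unfolding in_chart_def graph_def
  by (auto intro!: total_eqI span_zero)

lemma coord_graph_vec:
  "l \<in> K \<Longrightarrow> coord (graph_vec S b k) l = (if l \<in> S then (if l = k then 1 else 0) else b k l)"
  unfolding graph_vec_def by (simp add: coord_comb)

lemma graph_vec_in_graph:
  assumes "S \<subseteq> K" "k \<in> S" shows "graph_vec S b k \<in> graph S b"
proof -
  have fin: "finite S" using assms finite_K finite_subset by blast
  have "(\<Sum>k'\<in>S. coord (graph_vec S b k) k' * b k' l) = (\<Sum>k'\<in>S. if k' = k then b k' l else 0)" for l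
    using assms by (intro sum.cong) (auto simp: coord_graph_vec)
  then show ?thesis
    using assms fin unfolding graph_def by (auto simp: coord_graph_vec) (simp add: graph_vec_def)
qed

lemma graph_expand:
  assumes S: "S \<subseteq> K" and x: "x \<in> graph S b"
  shows "x = (\<Sum>k\<in>S. sc (coord x k) (graph_vec S b k))"
proof (rule total_eqI)
  have fin: "finite S" using S finite_K finite_subset by blast
  show "x \<in> total" using x graph_subset by auto
  show "(\<Sum>k\<in>S. sc (coord x k) (graph_vec S b k)) \<in> total"
    unfolding graph_vec_def by (intro span_sum span_scale) simp
  fix l assume l: "l \<in> K"
  have "coord (\<Sum>k\<in>S. sc (coord x k) (graph_vec S b k)) l
     = (\<Sum>k\<in>S. coord x k * (if l \<in> S then (if l = k then 1 else 0) else b k l))"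
    unfolding graph_vec_def using l by (subst coord_lincomb) (simp add: coord_comb)
  also have "\<dots> = coord x l"
  proof (cases "l \<in> S")
    case True
    have "(\<Sum>k\<in>S. coord x k * (if l = k then 1 else 0)) = (\<Sum>k\<in>S. if l = k then coord x k else 0)"
      by (intro sum.cong) auto
    then show ?thesis using True fin by simp
  next
    case False
    then show ?thesis using x l unfolding graph_def by simp
  qed
  finally show "coord x l = coord (\<Sum>k\<in>S. sc (coord x k) (graph_vec S b k)) l" ..
qed

lemma graph_eq_span: "S \<subseteq> K \<Longrightarrow> graph S b = span (graph_vec S b ` S)"
proof
  assume S: "S \<subseteq> K"
  show "span (graph_vec S b ` S) \<subseteq> graph S b"
    by (rule span_minimal[OF _ subspace_graph]) (use S graph_vec_in_graph in auto)
  show "graph S b \<subseteq> span (graph_vec S b ` S)"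
  proof
    fix x assume "x \<in> graph S b"
    from graph_expand[OF S this] have x: "x = (\<Sum>k\<in>S. sc (coord x k) (graph_vec S b k))" .
    show "x \<in> span (graph_vec S b ` S)"
      by (subst x, intro span_sum span_scale span_base) auto
  qed
qed

lemma independent_family:
  assumes ind: "\<And>y c. (\<Sum>c\<in>I. sc (y c) (g c)) = 0 \<Longrightarrow> c \<in> I \<Longrightarrow> y c = 0" and "finite I"
  shows "independent (g ` I)" "inj_on g I"
proof -
  show inj: "inj_on g I"
  proof (rule inj_onI, rule ccontr)
    fix i j assume ij: "i \<in> I" "j \<in> I" "g i = g j" "i \<noteq> j"
    \<comment> \<open>If members with different indices coincided, the coefficients 1 and -1 would
      give a nontrivial relation.\<close>
    let ?y = "\<lambda>c. if c = i then 1 else if c = j then -1 else 0 :: complex"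
    have "(\<Sum>c\<in>I. sc (?y c) (g c)) = (\<Sum>c\<in>{i, j}. sc (?y c) (g c))"
      using ij \<open>finite I\<close> by (intro sum.mono_neutral_right) auto
    also have "\<dots> = 0" using ij by (simp add: scale_minus_left)
    finally show False using ind[of ?y i] ij by simp
  qed
  show "independent (g ` I)"
    unfolding dependent_finite[OF finite_imageI[OF \<open>finite I\<close>]]
    using ind[of "\<lambda>c. _ (g c)"] by (auto simp: sum.reindex[OF inj] o_def)
qed

lemma dim_graph:
  assumes S: "S \<subseteq> K" shows "dim (graph S b) = card S"
proof -
  have fin: "finite S" using S finite_K finite_subset by blast
  have "y c = 0" if y: "(\<Sum>c\<in>S. sc (y c) (graph_vec S b c)) = 0" and c: "c \<in> S" for y c
  proof -
    have "0 = coord (\<Sum>k\<in>S. sc (y k) (graph_vec S b k)) c" using y by simp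
    also have "\<dots> = (\<Sum>k\<in>S. y k * (if c = k then 1 else 0))"
      unfolding graph_vec_def using c S by (subst coord_lincomb) (auto simp: coord_comb)
    also have "\<dots> = y c" using c fin by (simp add: if_distrib cong: if_cong)
    finally show ?thesis ..
  qed
  with fin have "independent (graph_vec S b ` S)" "inj_on (graph_vec S b) S"
    using independent_family[where I = S and g = "graph_vec S b"] by blast+
  then show ?thesis
    using graph_eq_span[OF S] dim_eq_card[of "graph_vec S b ` S" "graph S b"]
    by (metis card_image span_span)
qed

text \<open>The member of a graph whose \<open>S\<close>-coordinates form the \<open>k\<close>-th
  unit vector carries the \<open>k\<close>-th row of the matrix in its other coordinates.\<close>

lemma graph_inject:
  assumes "graph S b = graph S b'" "S \<subseteq> K" "k \<in> S" "l \<in> K - S"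
  shows "b k l = b' k l"
proof -
  have "graph_vec S b k \<in> graph S b'" using assms graph_vec_in_graph by auto
  then have "coord (graph_vec S b k) l = (\<Sum>k'\<in>S. coord (graph_vec S b k) k' * b' k' l)"
    using assms unfolding graph_def by blast
  also have "\<dots> = (\<Sum>k'\<in>S. if k' = k then b' k' l else 0)"
    using assms by (intro sum.cong) (auto simp: coord_graph_vec)
  also have "\<dots> = b' k l" using assms finite_K finite_subset[of S K] by simp
  finally show ?thesis using assms by (simp add: coord_graph_vec)
qed

subsection \<open>Frames\<close>

abbreviation col_span :: "nat \<Rightarrow> (nat \<Rightarrow> nat \<Rightarrow> complex) \<Rightarrow> 'v set" where
  "col_span d a \<equiv> span ((\<lambda>c. comb (a c)) ` {..<d})"

text \<open>For an enumeration \<open>s\<close> of \<open>S\<close> this is, up to sign, the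
  Pluecker coordinate of \<open>S\<close> computed from the columns \<open>a\<close>.\<close>

definition minor :: "nat \<Rightarrow> (nat \<Rightarrow> nat) \<Rightarrow> (nat \<Rightarrow> nat \<Rightarrow> complex) \<Rightarrow> complex" where
  "minor d s a = det_fun d (\<lambda>r c. a c (s r))"

text \<open>Divided by the minor, the determinant is by Cramer's rule the coefficient of column
  \<open>c\<close> in the combination whose \<open>S\<close>-coordinates form the
  \<open>k\<close>-th unit vector. Weighting with \<open>a c l\<close> gives the
  \<open>l\<close>-coordinate of that combination, hence the matrix entry at \<open>k\<close>,
  \<open>l\<close>.\<close>

definition cramer_num :: "nat \<Rightarrow> (nat \<Rightarrow> nat) \<Rightarrow> (nat \<Rightarrow> nat \<Rightarrow> complex) \<Rightarrow> nat \<Rightarrow> nat \<Rightarrow> complex" where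
  "cramer_num d s a k l =
     (\<Sum>c<d. det_fun d (\<lambda>r j. if j = c then (if s r = k then 1 else 0) else a j (s r)) * a c l)"

text \<open>At most \<open>d\<close> vectors span a space of dimension \<open>d\<close>, so a
  maximal independent subset already consists of all of them and no two columns coincide.\<close>

lemma frame_independent:
  assumes "dim (col_span d a) = d" "(\<Sum>c<d. sc (y c) (comb (a c))) = 0" "c < d"
  shows "y c = 0"
proof -
  let ?C = "(\<lambda>c. comb (a c)) ` {..<d}"
  obtain B where B: "B \<subseteq> ?C" "independent B" "?C \<subseteq> span B"
    by (rule maximal_independent_subset[of ?C])
  have "span B = span ?C"
    using B by (meson span_minimal span_mono subset_antisym subspace_span)
  then have "card B = d" using assms(1) dim_span_eq_card_independent[OF B(2)] by metis
  then have BC: "B = ?C" "card ?C = d"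
    using B(1) card_image_le[of "{..<d}" "\<lambda>c. comb (a c)"] card_mono[of ?C B] card_seteq[of ?C B]
    by auto
  then have inj: "inj_on (\<lambda>c. comb (a c)) {..<d}" by (intro eq_card_imp_inj_on) auto
  let ?i = "inv_into {..<d} (\<lambda>c. comb (a c))"
  have "(\<Sum>x\<in>?C. sc (y (?i x)) x) = 0"
    using assms(2) by (simp add: sum.reindex[OF inj] o_def inv_into_f_f[OF inj])
  then have "\<forall>x\<in>?C. y (?i x) = 0"
    using B(2) BC(1) independentD[of ?C ?C "\<lambda>x. y (?i x)"] by auto
  then show ?thesis using assms(3) inv_into_f_f[OF inj] by auto
qed

lemma col_span_iff: "x \<in> col_span d a \<longleftrightarrow> (\<exists>y. x = (\<Sum>c<d. sc (y c) (comb (a c))))"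
proof
  assume "x \<in> col_span d a"
  then show "\<exists>y. x = (\<Sum>c<d. sc (y c) (comb (a c)))"
  proof (induction rule: span_induct_alt)
    case base show ?case by (rule exI[of _ "\<lambda>_. 0"]) simp
  next
    case (step c x z)
    then obtain y j where y: "z = (\<Sum>c<d. sc (y c) (comb (a c)))" "j < d" "x = comb (a j)" by auto
    have "sc c x = (\<Sum>i<d. if i = j then sc c (comb (a i)) else 0)" using y by simp
    then have "sc c x + z = (\<Sum>i<d. (if i = j then sc c (comb (a i)) else 0) + sc (y i) (comb (a i)))"
      unfolding y(1) by (simp only: sum.distrib)
    also have "\<dots> = (\<Sum>i<d. sc ((if i = j then c else 0) + y i) (comb (a i)))"
      by (intro sum.cong) (auto simp: scale_left_distrib)
    finally show ?case by (rule exI[where x = "\<lambda>i. (if i = j then c else 0) + y i"])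
  qed
next
  assume "\<exists>y. x = (\<Sum>c<d. sc (y c) (comb (a c)))"
  then obtain y where "x = (\<Sum>c<d. sc (y c) (comb (a c)))" ..
  then show "x \<in> col_span d a" by (auto intro!: span_sum span_scale intro: span_base)
qed

lemma coord_cols:
  "l \<in> K \<Longrightarrow> coord (\<Sum>c<d. sc (y c) (comb (a c))) l = (\<Sum>c<d. a c l * y c)"
  by (subst coord_lincomb) (simp add: coord_comb mult.commute)

text \<open>A kernel vector of the square matrix is a combination of columns with vanishing
  \<open>S\<close>-coordinates, and by independence of the columns it is nonzero iff the combination
  is.\<close>

lemma minor_nonzero_iff:
  assumes S: "S \<subseteq> K" and s: "bij_betw s {..<d} S" and dim: "dim (col_span d a) = d"
  shows "minor d s a \<noteq> 0 \<longleftrightarrow> in_chart S (col_span d a)"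
proof -
  have sK: "r < d \<Longrightarrow> s r \<in> K" for r using subsetD[OF S] bij_betw_apply[OF s] by simp
  have sS: "S = s ` {..<d}" using s by (simp add: bij_betw_def)
  have zero: "(\<forall>k\<in>S. coord x k = 0) \<longleftrightarrow> (\<forall>r<d. coord x (s r) = 0)" for x
    unfolding sS by auto
  have nz: "(\<exists>c<d. y c \<noteq> 0) \<longleftrightarrow> (\<Sum>c<d. sc (y c) (comb (a c))) \<noteq> 0" for y
  proof -
    have "(\<Sum>c<d. sc (y c) (comb (a c))) = 0" if "\<forall>c<d. y c = 0"
      using that by (intro sum.neutral) simp
    then show ?thesis using frame_independent[OF dim, of y] by metis
  qed
  have "minor d s a = 0 \<longleftrightarrow> (\<exists>y. (\<Sum>c<d. sc (y c) (comb (a c))) \<noteq> 0 \<and>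
      (\<forall>r<d. coord (\<Sum>c<d. sc (y c) (comb (a c))) (s r) = 0))"
    unfolding minor_def det_fun_eq_0_iff nz by (simp add: coord_cols sK)
  also have "\<dots> \<longleftrightarrow> \<not> in_chart S (col_span d a)"
  proof -
    have "in_chart S (col_span d a) \<longleftrightarrow> (\<forall>x. x \<in> col_span d a \<longrightarrow> (\<forall>r<d. coord x (s r) = 0) \<longrightarrow> x = 0)"
      unfolding in_chart_def zero by (rule Ball_def)
    also have "\<dots> \<longleftrightarrow> (\<forall>y. (\<forall>r<d. coord (\<Sum>c<d. sc (y c) (comb (a c))) (s r) = 0) \<longrightarrow>
        (\<Sum>c<d. sc (y c) (comb (a c))) = 0)"
      unfolding col_span_iff by fast
    finally show ?thesis by auto
  qed
  finally show ?thesis by blast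
qed

text \<open>Cramer's rule puts every graph vector into the column span. Conversely, subtracting from
  a vector of the span the graph element with the same \<open>S\<close>-coordinates leaves a vector
  that vanishes on \<open>S\<close>, which is zero because the span lies in the chart.\<close>

lemma col_span_eq_graph:
  assumes S: "S \<subseteq> K" and s: "bij_betw s {..<d} S" and dim: "dim (col_span d a) = d"
    and nz: "minor d s a \<noteq> 0"
  shows "col_span d a = graph S (\<lambda>k l. cramer_num d s a k l / minor d s a)"
    (is "?U = graph S ?b")
proof
  have fin: "finite S" using S finite_K finite_subset by blast
  have sK: "r < d \<Longrightarrow> s r \<in> K" for r using subsetD[OF S] bij_betw_apply[OF s] by simp
  have vecU: "graph_vec S ?b k \<in> ?U" if k: "k \<in> S" for k
  proof -
    obtain y where y: "\<And>r. r < d \<Longrightarrow> (\<Sum>c<d. a c (s r) * y c) = (if s r = k then 1 else 0)"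
      using det_fun_solve[of d "\<lambda>r c. a c (s r)" "\<lambda>r. if s r = k then 1 else 0"] nz
      unfolding minor_def by blast
    let ?x = "\<Sum>c<d. sc (y c) (comb (a c))"
    have yc: "y c = det_fun d (\<lambda>r j. if j = c then (if s r = k then 1 else 0) else a j (s r)) / minor d s a"
      if "c < d" for c
      using det_fun_cramer[OF y that] nz unfolding minor_def by (simp add: field_simps)
    have "graph_vec S ?b k = ?x"
    proof (rule total_eqI)
      show "graph_vec S ?b k \<in> total" by (simp add: graph_vec_def)
      show "?x \<in> total" by (intro span_sum span_scale) simp
      fix l assume l: "l \<in> K"
      show "coord (graph_vec S ?b k) l = coord ?x l"
      proof (cases "l \<in> S")
        case True
        then obtain r where "r < d" "l = s r" using s by (auto simp: bij_betw_def)
        then show ?thesis using y[of r] l True by (simp add: coord_graph_vec coord_cols)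
      next
        case False
        have "coord ?x l = (\<Sum>c<d. a c l * y c)" using l by (rule coord_cols)
        also have "\<dots> = ?b k l"
          unfolding cramer_num_def sum_divide_distrib by (intro sum.cong) (simp_all add: yc)
        finally have "coord ?x l = ?b k l" .
        then show ?thesis using False l by (simp add: coord_graph_vec)
      qed
    qed
    then show ?thesis unfolding col_span_iff by (rule exI[where x = y])
  qed
  show "graph S ?b \<subseteq> ?U"
    unfolding graph_eq_span[OF S] by (rule span_minimal) (use vecU in auto)
  have Ut: "?U \<subseteq> total" by (rule span_minimal) auto
  show "?U \<subseteq> graph S ?b"
  proof
    fix x assume x: "x \<in> ?U"
    let ?z = "\<Sum>k\<in>S. sc (coord x k) (graph_vec S ?b k)"
    have z: "?z \<in> graph S ?b"
      by (intro subspace_sum subspace_scale subspace_graph graph_vec_in_graph S)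
    have "x - ?z = 0"
    proof -
      have "x - ?z \<in> ?U" using x subsetD[OF \<open>graph S ?b \<subseteq> ?U\<close> z] by (rule span_diff)
      moreover have "coord (x - ?z) k = 0" if "k \<in> S" for k
      proof -
        have "coord ?z k = (\<Sum>j\<in>S. coord x j * (if k = j then 1 else 0))"
          unfolding graph_vec_def using that S by (subst coord_lincomb) (auto simp: coord_comb)
        also have "\<dots> = coord x k" using that fin by (simp add: if_distrib cong: if_cong)
        finally show ?thesis using subsetD[OF Ut x] subsetD[OF graph_subset z] by (simp add: coord_diff)
      qed
      ultimately show ?thesis
        using iffD1[OF minor_nonzero_iff[OF S s dim] nz] unfolding in_chart_def by blast
    qed
    then show "x \<in> graph S ?b" using z by simp
  qed
qed

lemma exists_frame:
  assumes U: "subspace U" "U \<subseteq> total" "dim U = d"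
  shows "\<exists>a. col_span d a = U \<and> (\<forall>c k. \<not> (c < d \<and> k \<in> K) \<longrightarrow> a c k = 0)"
proof -
  obtain B where B: "B \<subseteq> U" "independent B" "U \<subseteq> span B" "card B = dim U"
    by (rule basis_exists)
  have "finite B"
    using independent_span_bound[of "v ` K" B] B U finite_K by auto
  then obtain g where g: "bij_betw g {..<d} B"
    using B U ex_bij_betw_nat_finite[of B] by (auto simp: lessThan_atLeast0)
  let ?a = "\<lambda>c k. if c < d \<and> k \<in> K then coord (g c) k else 0"
  have "comb (?a c) = g c" if "c < d" for c
  proof -
    have "g c \<in> B" using that g by (auto simp: bij_betw_def)
    then have "g c \<in> total" using B U by blast
    then show ?thesis using that comb_cong[of "?a c" "coord (g c)"] by (simp add: comb_coord)
  qed
  then have "(\<lambda>c. comb (?a c)) ` {..<d} = g ` {..<d}" by (intro image_cong) auto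
  then have "(\<lambda>c. comb (?a c)) ` {..<d} = B" using g by (simp only: bij_betw_def)
  moreover have "span B = U" using B U by (simp add: span_minimal subset_antisym)
  ultimately have "col_span d ?a = U" by (simp only:)
  then show ?thesis by (intro exI[of _ ?a] conjI) auto
qed

lemma graph_if_in_chart:
  assumes U: "subspace U" "U \<subseteq> total" "dim U = card S" and S: "S \<subseteq> K" and ch: "in_chart S U"
  shows "\<exists>b. U = graph S b"
proof -
  obtain a where a: "col_span (card S) a = U" using exists_frame[OF U] by blast
  obtain s where s: "bij_betw s {..<card S} S"
    using ex_bij_betw_nat_finite[of S] S finite_K finite_subset by (auto simp: lessThan_atLeast0)
  have dim: "dim (col_span (card S) a) = card S" using a U by metis
  have "minor (card S) s a \<noteq> 0" using minor_nonzero_iff[OF S s dim] a ch by simp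
  from col_span_eq_graph[OF S s dim this] a show ?thesis by metis
qed

lemma exists_chart:
  assumes U: "subspace U" "U \<subseteq> total"
  shows "\<exists>S\<subseteq>K. card S = dim U \<and> in_chart S U"
proof -
  obtain B where B: "B \<subseteq> U" "independent B" "U \<subseteq> span B" "card B = dim U"
    by (rule basis_exists)
  have BU: "span B = U" using B U by (simp add: span_minimal subset_antisym)
  have finB: "finite B"
    using independent_span_bound[of "v ` K" B] B U finite_K by auto
  obtain E where E: "B \<subseteq> E" "E \<subseteq> B \<union> v ` K" "independent E" "B \<union> v ` K \<subseteq> span E"
    using maximal_independent_subset_extend[of B "B \<union> v ` K"] B by blast
  have finE: "finite E" using E finB finite_K finite_subset by blast
  have spanE: "span E = total"
  proof
    show "span E \<subseteq> total" by (rule span_minimal) (use E B U span_superset in blast)+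
    show "total \<subseteq> span E" by (rule span_minimal) (use E in auto)
  qed
  have cardE: "card E = card K"
    using dim_span_eq_card_independent[OF E(3)] dim_span_eq_card_independent[OF independent_v] spanE
    by (simp add: card_image[OF inj_v])
  define T where "T = {l \<in> K. v l \<in> E - B}"
  have vT: "v ` T = E - B" using E unfolding T_def by auto
  have TK: "T \<subseteq> K" unfolding T_def by auto
  have "card T = card (E - B)"
    using card_image[of v T] vT inj_on_subset[OF inj_v TK] by simp
  also have "\<dots> = card K - card B" using cardE E finB by (simp add: card_Diff_subset)
  finally have "card T = card K - card B" .
  moreover have "card B \<le> card K" using cardE E finE card_mono by metis
  ultimately have cS: "card (K - T) = dim U"
    using TK B finite_K by (simp add: card_Diff_subset finite_subset)
  have "x = 0" if x: "x \<in> U" "\<forall>k\<in>K - T. coord x k = 0" for x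
  proof -
    have "x = comb (coord x)" using x U comb_coord by auto
    also have "\<dots> = (\<Sum>k\<in>T. sc (coord x k) (v k))"
      unfolding comb_def using x TK finite_K by (intro sum.mono_neutral_right) auto
    also have "\<dots> \<in> span (v ` T)" by (intro span_sum span_scale span_base) auto
    finally have "x \<in> span (E - B)" using vT by simp
    moreover have "x \<in> span B" using x BU by simp
    \<comment> \<open>The expansion of \<open>x\<close> in \<open>E\<close> is supported both on
      \<open>B\<close> and on its complement.\<close>
    ultimately have "representation E x = representation (E - B) x" "representation E x = representation B x"
      using E(1) by (auto intro!: representation_extend[OF E(3)])
    then have "representation E x u = 0" for u
      using representation_ne_zero[of "E - B" x u] representation_ne_zero[of B x u] by auto
    moreover have "(\<Sum>u\<in>E. sc (representation E x u) u) = x"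
      using sum_representation_eq[OF E(3) _ finE, of x] x U spanE by auto
    ultimately show ?thesis by simp
  qed
  then show ?thesis unfolding in_chart_def using cS by (intro exI[of _ "K - T"]) auto
qed

subsection \<open>Echelon forms\<close>

text \<open>The pivots come from a chart with minimal index sum: an entry to the left of its pivot could be
  exchanged with it.\<close>

lemma exists_echelon:
  assumes U: "subspace U" "U \<subseteq> total"
  shows "\<exists>S\<subseteq>K. \<exists>b. card S = dim U \<and> U = graph S b \<and> (\<forall>k\<in>S. \<forall>l\<in>K - S. b k l \<noteq> 0 \<longrightarrow> k < l)"
proof -
  let ?P = "\<lambda>S. S \<subseteq> K \<and> card S = dim U \<and> in_chart S U"
  obtain S0 where "?P S0" using exists_chart[OF U] by auto
  from ex_has_least_nat[of ?P, OF this, of "\<lambda>S. \<Sum>S"]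
  obtain S where S: "?P S" and min: "\<And>S'. ?P S' \<Longrightarrow> \<Sum>S \<le> \<Sum>S'" by auto
  obtain b where b: "U = graph S b" using graph_if_in_chart[OF U, of S] S by auto
  have fin: "finite S" using S finite_K finite_subset by blast
  have "k < l" if kl: "k \<in> S" "l \<in> K - S" "b k l \<noteq> 0" for k l
  proof (rule ccontr)
    assume "\<not> k < l"
    then have lk: "l < k" using kl by (metis DiffD2 linorder_neqE_nat)
    \<comment> \<open>The exchange lowers the index sum, so a contradiction follows once
      \<open>?S\<close> is known to be a chart.\<close>
    let ?S = "insert l (S - {k})"
    have "in_chart ?S U"
      unfolding in_chart_def
    proof (intro ballI impI)
      fix x assume x: "x \<in> U" "\<forall>k\<in>?S. coord x k = 0"
      have "0 = coord x l" using x by simp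
      also have "\<dots> = (\<Sum>j\<in>S. coord x j * b j l)" using x(1) kl(2) unfolding b graph_def by simp
      also have "\<dots> = (\<Sum>j\<in>S. if j = k then coord x k * b k l else 0)"
        using x by (intro sum.cong) auto
      also have "\<dots> = coord x k * b k l" using fin kl(1) by simp
      finally have "coord x k = 0" using kl by simp
      then have "\<forall>k\<in>S. coord x k = 0" using x by auto
      with x(1) conjunct2[OF conjunct2[OF S]] show "x = 0" unfolding in_chart_def by simp
    qed
    moreover have "card ?S = card S" using kl fin card_Suc_Diff1[of S k] by simp
    ultimately have "\<Sum>S \<le> \<Sum>?S" using min[of ?S] S kl by auto
    also have "\<dots> = l + \<Sum>(S - {k})" using fin kl by simp
    also have "\<dots> < k + \<Sum>(S - {k})" using lk by simp
    also have "\<dots> = \<Sum>S" using fin kl by (simp add: sum.remove)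
    finally show False by simp
  qed
  then have "\<forall>k\<in>S. \<forall>l\<in>K - S. b k l \<noteq> 0 \<longrightarrow> k < l" by blast
  then show ?thesis using S b by (intro exI[of _ S] exI[of _ b] conjI) auto
qed

text \<open>Let \<open>m\<close> be the largest index at which the sets differ. If \<open>m\<close>
  were in \<open>S'\<close>, the echelon vector with pivot \<open>m\<close> would have its other
  entries beyond \<open>m\<close> and outside \<open>S'\<close>, hence outside \<open>S\<close>. It
  would vanish on \<open>S\<close>, against the chart property.\<close>

lemma echelon_weight:
  assumes S: "S \<subseteq> K" and S': "S' \<subseteq> K" and ne: "S \<noteq> S'"
    and ch: "in_chart S (graph S' b)" and up: "\<And>k l. k \<in> S' \<Longrightarrow> l \<in> K - S' \<Longrightarrow> b k l \<noteq> 0 \<Longrightarrow> k < l"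
  shows "(\<Sum>k\<in>S'. 2 ^ k) < (\<Sum>k\<in>S. 2 ^ k :: nat)"
proof -
  have fin: "finite S" "finite S'" using S S' finite_K finite_subset by blast+
  let ?D = "(S - S') \<union> (S' - S)"
  define m where "m = Max ?D"
  have mD: "m \<in> ?D" unfolding m_def using fin ne by (intro Max_in) auto
  have above: "k \<in> S \<longleftrightarrow> k \<in> S'" if "m < k" for k
  proof -
    have "k \<notin> ?D" using that Max_ge[of ?D k] fin unfolding m_def by (auto simp: not_le[symmetric])
    then show ?thesis by blast
  qed
  have "m \<notin> S' - S"
  proof
    assume m: "m \<in> S' - S"
    have "coord (graph_vec S' b m) k = 0" if k: "k \<in> S" for k
    proof (cases "m < k")
      case True then show ?thesis using above k S' by (auto simp: coord_graph_vec)
    next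
      case False
      have "k \<noteq> m" "k \<in> K" using m k S by auto
      with False show ?thesis using up[of m k] m k by (auto simp: coord_graph_vec)
    qed
    moreover have "graph_vec S' b m \<in> graph S' b" using m S' by (intro graph_vec_in_graph) auto
    ultimately have "graph_vec S' b m = 0" using ch unfolding in_chart_def by simp
    then have "coord (graph_vec S' b m) m = 0" by simp
    then show False using m S' by (auto simp: coord_graph_vec)
  qed
  then have m: "m \<in> S - S'" using mD by auto
  let ?H = "{k \<in> S. m < k}"
  \<comment> \<open>The sets agree above \<open>m\<close>, and everything in \<open>S'\<close> below
    \<open>m\<close> weighs less than the \<open>2 ^ m\<close> contributed by \<open>m\<close> to
    \<open>S\<close>.\<close>
  have "S' = {k \<in> S'. k < m} \<union> ?H"
  proof (intro equalityI subsetI)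
    fix k assume k: "k \<in> S'"
    then have "k \<noteq> m" using m by blast
    then show "k \<in> {k \<in> S'. k < m} \<union> ?H" using k above by (cases "m < k") auto
  next
    fix k assume "k \<in> {k \<in> S'. k < m} \<union> ?H"
    then show "k \<in> S'" using above by (cases "m < k") auto
  qed
  then have "(\<Sum>k\<in>S'. 2 ^ k :: nat) = (\<Sum>k\<in>{k \<in> S'. k < m} \<union> ?H. 2 ^ k)" by simp
  also have "\<dots> = (\<Sum>k\<in>{k \<in> S'. k < m}. 2 ^ k) + (\<Sum>k\<in>?H. 2 ^ k)"
    using fin by (intro sum.union_disjoint) auto
  also have "(\<Sum>k\<in>{k \<in> S'. k < m}. 2 ^ k :: nat) \<le> (\<Sum>k<m. 2 ^ k)"
    by (intro sum_mono2) auto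
  also have "(\<Sum>k<m. 2 ^ k :: nat) < 2 ^ m"
    by (induction m) auto
  finally have "(\<Sum>k\<in>S'. 2 ^ k :: nat) < 2 ^ m + (\<Sum>k\<in>?H. 2 ^ k)" by simp
  also have "\<dots> = (\<Sum>k\<in>insert m ?H. 2 ^ k)" using fin by simp
  also have "\<dots> \<le> (\<Sum>k\<in>S. 2 ^ k)" using m fin by (intro sum_mono2) auto
  finally show ?thesis .
qed

subsection \<open>The torus action\<close>

definition scale_vec :: "complex \<Rightarrow> 'v \<Rightarrow> 'v" where
  "scale_vec t x = comb (\<lambda>k. t ^ k * coord x k)"

lemma coord_scale_vec: "k \<in> K \<Longrightarrow> coord (scale_vec t x) k = t ^ k * coord x k"
  unfolding scale_vec_def by (simp add: coord_comb)

lemma scale_vec_inverse: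
  assumes "t \<noteq> 0" "x \<in> total" shows "scale_vec t (scale_vec (1 / t) x) = x"
proof (rule total_eqI)
  show "scale_vec t (scale_vec (1 / t) x) \<in> total" by (simp add: scale_vec_def)
qed (use assms in \<open>auto simp: coord_scale_vec power_divide\<close>)

lemma scale_vec_graph_subset:
  assumes "t \<noteq> 0" "S \<subseteq> K"
  shows "scale_vec t ` graph S b \<subseteq> graph S (\<lambda>k l. t ^ l / t ^ k * b k l)"
proof
  fix z assume "z \<in> scale_vec t ` graph S b"
  then obtain x where x: "x \<in> graph S b" "z = scale_vec t x" by blast
  have "coord z l = (\<Sum>k\<in>S. coord z k * (t ^ l / t ^ k * b k l))" if l: "l \<in> K - S" for l
  proof -
    have "coord x l = (\<Sum>k\<in>S. coord x k * b k l)" using x(1) l unfolding graph_def by blast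
    then have "coord z l = t ^ l * (\<Sum>k\<in>S. coord x k * b k l)"
      using x(2) l by (simp add: coord_scale_vec)
    also have "\<dots> = (\<Sum>k\<in>S. coord z k * (t ^ l / t ^ k * b k l))"
      unfolding sum_distrib_left x(2) using assms
      by (intro sum.cong) (simp_all add: coord_scale_vec subsetD[OF assms(2)])
    finally show ?thesis .
  qed
  moreover have "z \<in> total" unfolding x(2) scale_vec_def by (rule comb_in_total)
  ultimately show "z \<in> graph S (\<lambda>k l. t ^ l / t ^ k * b k l)"
    unfolding graph_def by blast
qed

text \<open>The reverse inclusion is the previous one for \<open>1 / t\<close>, which undoes both
  the scaling and the change of the matrix.\<close>

lemma scale_vec_graph:
  assumes "t \<noteq> 0" "S \<subseteq> K"
  shows "scale_vec t ` graph S b = graph S (\<lambda>k l. t ^ l / t ^ k * b k l)"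
proof
  show "graph S (\<lambda>k l. t ^ l / t ^ k * b k l) \<subseteq> scale_vec t ` graph S b"
  proof
    fix x assume x: "x \<in> graph S (\<lambda>k l. t ^ l / t ^ k * b k l)"
    let ?b = "\<lambda>k l. (1 / t) ^ l / (1 / t) ^ k * (t ^ l / t ^ k * b k l)"
    have "scale_vec (1 / t) x \<in> graph S ?b"
      using scale_vec_graph_subset[of "1 / t" S "\<lambda>k l. t ^ l / t ^ k * b k l"] x assms by auto
    also have "graph S ?b = graph S b"
      by (rule graph_cong) (use assms in \<open>auto simp: power_divide\<close>)
    finally have *: "scale_vec (1 / t) x \<in> graph S b" .
    have "x = scale_vec t (scale_vec (1 / t) x)"
      using scale_vec_inverse[OF assms(1)] subsetD[OF graph_subset x] by simp
    then show "x \<in> scale_vec t ` graph S b" using * by (rule image_eqI)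
  qed
qed (rule scale_vec_graph_subset[OF assms])

end

section \<open>Families of graphs in a representation\<close>

text \<open>
  The coefficients of a subrepresentation with given pivots: those with \<open>k\<close> not coming from a pivot
  at the previous vertex are free, and the others are determined by recursion along the quiver.
\<close>

function solve :: "(nat \<Rightarrow> nat set) \<Rightarrow> (nat \<Rightarrow> nat \<Rightarrow> nat \<Rightarrow> bool) \<Rightarrow> (nat \<Rightarrow> nat \<Rightarrow> nat \<Rightarrow> complex) \<Rightarrow>
    nat \<Rightarrow> nat \<Rightarrow> nat \<Rightarrow> complex" where
  "solve S P x i k l =
     (if P i k l then
        if 1 < i \<and> k \<in> S (i - 1) then
          solve S P x (i - 1) k l -
            (\<Sum>j\<in>{j \<in> S i. k < j \<and> j < l}. solve S P x (i - 1) k j * solve S P x i j l)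
        else x i k l
      else 0)"
  by auto
text \<open>Calls either go back one vertex or stay at the vertex with a smaller gap
  \<open>l - k\<close>; the bounds \<open>k < j\<close> and \<open>j < l\<close> serve the second
  case.\<close>

termination
  by (relation "measures [\<lambda>(S, P, x, i, k, l). i, \<lambda>(S, P, x, i, k, l). l - k]") auto

declare solve.simps [simp del]

lemma solve_eq_0: "\<not> P i k l \<Longrightarrow> solve S P x i k l = 0"
  by (subst solve.simps) simp

lemma solve_free: "P i k l \<Longrightarrow> \<not> (1 < i \<and> k \<in> S (i - 1)) \<Longrightarrow> solve S P x i k l = x i k l"
  by (subst solve.simps) auto

lemma polyfun_solve:
  assumes "\<And>i k l. (\<lambda>y. x y i k l) \<in> polyfun"
  shows "(\<lambda>y. solve S P (x y) i k l) \<in> polyfun"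
\<comment> \<open>Which recursive calls occur does not depend on the values of the free coordinates.
  A dummy assignment in the induction rule therefore yields hypotheses about the function of
  \<open>y\<close>, not about a single \<open>y\<close>.\<close>
proof (induction S P "(\<lambda>_ _ _. 0) :: nat \<Rightarrow> nat \<Rightarrow> nat \<Rightarrow> complex" i k l rule: solve.induct)
  case (1 S P i k l)
  show ?case
  proof (cases "P i k l")
    case P: True
    show ?thesis
    proof (cases "1 < i \<and> k \<in> S (i - 1)")
      case True
      have "(\<lambda>y. solve S P (x y) (i - 1) k l - (\<Sum>j\<in>{j \<in> S i. k < j \<and> j < l}.
          solve S P (x y) (i - 1) k j * solve S P (x y) i j l)) \<in> polyfun"
        using 1 P True by (intro polyfun_diff polyfun_sum polyfun.mult) auto
      then show ?thesis using P True by (subst solve.simps) simp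
    next
      case False
      then show ?thesis using P assms by (simp only: solve_free not_False_eq_True)
    qed
  next
    case False
    then show ?thesis by (simp only: solve_eq_0 not_False_eq_True polyfun.const)
  qed
qed

locale numbered_rep = vector_space sc
  for sc :: "complex \<Rightarrow> 'v::ab_group_add \<Rightarrow> 'v" +
  fixes n :: nat and V :: "nat \<Rightarrow> 'v set" and f :: "nat \<Rightarrow> 'v \<Rightarrow> 'v" and K :: "nat \<Rightarrow> nat set"
    and v :: "nat \<Rightarrow> nat \<Rightarrow> 'v" and e :: "nat \<Rightarrow> nat"
  assumes rep: "quiver_rep sc n V f" and basis: "numbered_basis sc n V f K v"
begin

abbreviation "coordi i \<equiv> numbered_space.coord sc (K i) (v i)"
abbreviation "graphi i \<equiv> numbered_space.graph sc (K i) (v i)"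
abbreviation "graph_veci i \<equiv> numbered_space.graph_vec sc (K i) (v i)"

section \<open>The maps in the numbered bases\<close>

lemma space: "i \<in> {1..n} \<Longrightarrow> numbered_space sc (K i) (v i)"
  using basis unfolding numbered_basis_def by unfold_locales auto

lemma V_eq: "i \<in> {1..n} \<Longrightarrow> V i = span (v i ` K i)"
  using basis unfolding numbered_basis_def by auto

lemma finite_K: "i \<in> {1..n} \<Longrightarrow> finite (K i)"
  using basis unfolding numbered_basis_def by auto

lemma f_in_V: "i \<in> {1..<n} \<Longrightarrow> x \<in> V i \<Longrightarrow> f i x \<in> V (Suc i)"
  using rep unfolding quiver_rep_def by blast

lemma f_zero: "i \<in> {1..<n} \<Longrightarrow> f i 0 = 0"
proof -
  assume i: "i \<in> {1..<n}"
  have "0 \<in> V i" using V_eq[of i] i span_zero by auto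
  then have "f i (0 + 0) = f i 0 + f i 0" using rep i unfolding quiver_rep_def by blast
  then show ?thesis by simp
qed

lemma f_lincomb:
  assumes i: "i \<in> {1..<n}" and g: "\<And>k. k \<in> I \<Longrightarrow> g k \<in> V i"
  shows "f i (\<Sum>k\<in>I. sc (a k) (g k)) = (\<Sum>k\<in>I. sc (a k) (f i (g k)))"
  using g
proof (induction I rule: infinite_finite_induct)
  case (insert k I)
  have *: "sc (a k) (g k) \<in> V i" "(\<Sum>k\<in>I. sc (a k) (g k)) \<in> V i" "g k \<in> V i"
    using insert.prems i V_eq[of i] by (auto intro!: span_sum span_scale)
  have "f i (sc (a k) (g k) + (\<Sum>k\<in>I. sc (a k) (g k)))
      = f i (sc (a k) (g k)) + f i (\<Sum>k\<in>I. sc (a k) (g k))"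
    using rep i *(1,2) unfolding quiver_rep_def by blast
  moreover have "f i (sc (a k) (g k)) = sc (a k) (f i (g k))"
    using rep i *(3) unfolding quiver_rep_def by blast
  ultimately show ?case using insert by simp
qed (use f_zero[OF i] in auto)

lemma v_in_V: "i \<in> {1..n} \<Longrightarrow> k \<in> K i \<Longrightarrow> v i k \<in> V i"
  using V_eq span_base by auto

lemma v_nonzero:
  assumes "i \<in> {1..n}" "k \<in> K i" shows "v i k \<noteq> 0"
proof
  interpret ns: numbered_space sc "K i" "v i" using assms by (intro space)
  assume "v i k = 0"
  then show False using ns.coord_v[of k k] assms ns.coord_zero by simp
qed

text \<open>The vertices at which \<open>k\<close> occurs form an interval along which the basis
  vectors are mapped to each other, so the image cannot vanish while \<open>k\<close> still occurs
  at the next vertex.\<close>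

lemma f_v:
  assumes i: "i \<in> {1..<n}" and k: "k \<in> K i"
  shows "f i (v i k) = (if k \<in> K (Suc i) then v (Suc i) k else 0)"
proof (cases "k \<in> K (Suc i)")
  case True
  have "k \<in> (\<Union>i\<in>{1..n}. K i)" using i k by auto
  then obtain a b where ab: "{i\<in>{1..n}. k \<in> K i} = {a..b}" "\<forall>i\<in>{a..<b}. f i (v i k) = v (Suc i) k"
    using basis unfolding numbered_basis_def by blast
  have "i \<in> {i\<in>{1..n}. k \<in> K i}" "Suc i \<in> {i\<in>{1..n}. k \<in> K i}" using True i k by auto
  then have "i \<in> {a..<b}" unfolding ab(1) by auto
  then show ?thesis using ab(2) True by auto
next
  case False
  then show ?thesis using basis i k unfolding numbered_basis_def by auto
qed

text \<open>This is where condition (2) on the numbering enters.\<close>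

lemma kernel_upward:
  assumes i: "i \<in> {1..<n}" and k: "k \<in> K i" "k \<notin> K (Suc i)" and j: "j \<in> K i" "k < j"
  shows "j \<notin> K (Suc i)"
proof
  assume "j \<in> K (Suc i)"
  then have "f i (v i j) \<noteq> 0" using f_v[OF i j(1)] v_nonzero[of "Suc i" j] i by auto
  moreover have "f i (v i k) = 0" using f_v[OF i k(1)] k by simp
  ultimately show False using basis i k j unfolding numbered_basis_def by blast
qed

lemma coord_f:
  assumes i: "i \<in> {1..<n}" and x: "x \<in> V i" and l: "l \<in> K (Suc i)"
  shows "coordi (Suc i) (f i x) l = (if l \<in> K i then coordi i x l else 0)"
proof -
  interpret ns: numbered_space sc "K i" "v i" using i by (intro space) auto
  interpret ns': numbered_space sc "K (Suc i)" "v (Suc i)" using i by (intro space) auto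
  have i': "i \<in> {1..n}" "Suc i \<in> {1..n}" using i by auto
  have "x = (\<Sum>k\<in>K i. sc (ns.coord x k) (v i k))"
    using ns.comb_coord[of x] x V_eq[OF i'(1)] unfolding ns.comb_def by simp
  then have "f i x = f i (\<Sum>k\<in>K i. sc (ns.coord x k) (v i k))" by simp
  also have "\<dots> = (\<Sum>k\<in>K i. sc (ns.coord x k) (f i (v i k)))"
    using v_in_V[OF i'(1)] by (intro f_lincomb i)
  also have "\<dots> = (\<Sum>k\<in>K i. sc (if k \<in> K (Suc i) then ns.coord x k else 0)
      (if k \<in> K (Suc i) then v (Suc i) k else 0))"
    using f_v[OF i] by (intro sum.cong) auto
  finally have fx: "f i x = \<dots>" .
  have "ns'.coord (f i x) l = (\<Sum>k\<in>K i. ns'.coord (sc (if k \<in> K (Suc i) then ns.coord x k else 0)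
      (if k \<in> K (Suc i) then v (Suc i) k else 0)) l)"
    unfolding fx using ns'.v_in_total by (intro ns'.coord_sum) (auto intro: span_scale span_zero)
  also have "\<dots> = (\<Sum>k\<in>K i. if k = l then ns.coord x k else 0)"
    using l ns'.v_in_total by (intro sum.cong) (auto simp: ns'.coord_scale ns'.coord_v)
  finally show ?thesis using finite_K[OF i'(1)] by simp
qed

definition families :: "(nat \<Rightarrow> nat set) set" where
  "families = (\<Pi>\<^sub>E i\<in>{1..n}. {T. T \<subseteq> K i \<and> card T = e i})"

definition fam :: "(nat \<Rightarrow> nat set) \<Rightarrow> (nat \<Rightarrow> nat \<Rightarrow> nat \<Rightarrow> complex) \<Rightarrow> nat \<Rightarrow> 'v set" where
  "fam S b = (\<lambda>i\<in>{1..n}. graphi i (S i) (b i))"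

definition entry :: "(nat \<Rightarrow> nat set) \<Rightarrow> nat \<Rightarrow> nat \<Rightarrow> nat \<Rightarrow> bool" where
  "entry S i k l \<longleftrightarrow> i \<in> {1..n} \<and> k \<in> S i \<and> l \<in> K i - S i \<and> k < l"

text \<open>Zeros are required at all positions that an echelon matrix does not use, also outside
  the range of vertices, so that a point of a cell determines \<open>b\<close> as a
  function.\<close>

definition upper :: "(nat \<Rightarrow> nat set) \<Rightarrow> (nat \<Rightarrow> nat \<Rightarrow> nat \<Rightarrow> complex) \<Rightarrow> bool" where
  "upper S b \<longleftrightarrow> (\<forall>i k l. b i k l \<noteq> 0 \<longrightarrow> entry S i k l)"

text \<open>\<open>compatible S\<close> says that the vectors \<open>v i k\<close> with \<open>k \<in> S i\<close> span a subrepresentation.\<close>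

definition compatible :: "(nat \<Rightarrow> nat set) \<Rightarrow> bool" where
  "compatible S \<longleftrightarrow> (\<forall>i\<in>{1..<n}. S i \<inter> K (Suc i) \<subseteq> S (Suc i))"

text \<open>For compatible \<open>S\<close> and upper \<open>b\<close>, the image under
  \<open>f i\<close> of the \<open>k\<close>-th graph vector has coordinate 1 at \<open>k\<close>
  and \<open>b i k j\<close> at the other pivots \<open>j\<close> of the next vertex. The right-hand
  side is the \<open>l\<close>-coordinate that the next graph prescribes for such a vector.\<close>

definition relations :: "(nat \<Rightarrow> nat set) \<Rightarrow> (nat \<Rightarrow> nat \<Rightarrow> nat \<Rightarrow> complex) \<Rightarrow> bool" where
  "relations S b \<longleftrightarrow> (\<forall>i\<in>{1..<n}. \<forall>k\<in>S i \<inter> K (Suc i). \<forall>l\<in>K (Suc i) - S (Suc i).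
     b i k l = b (Suc i) k l + (\<Sum>j\<in>S (Suc i). b i k j * b (Suc i) j l))"

lemma families_subset: "S \<in> families \<Longrightarrow> i \<in> {1..n} \<Longrightarrow> S i \<subseteq> K i"
  unfolding families_def by auto

lemma families_card: "S \<in> families \<Longrightarrow> i \<in> {1..n} \<Longrightarrow> card (S i) = e i"
  unfolding families_def by auto

lemma finite_families: "finite families"
  unfolding families_def
proof (rule finite_PiE)
  fix i assume "i \<in> {1..n}"
  then show "finite {T. T \<subseteq> K i \<and> card T = e i}"
    by (intro finite_subset[OF _ finite_Pow_iff[THEN iffD2, OF finite_K]]) auto
qed simp

lemma fam_apply: "i \<in> {1..n} \<Longrightarrow> fam S b i = graphi i (S i) (b i)"
  unfolding fam_def by simp

lemma fam_cong:
  assumes "\<And>i k l. i \<in> {1..n} \<Longrightarrow> k \<in> S i \<Longrightarrow> l \<in> K i - S i \<Longrightarrow> b i k l = b' i k l"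
  shows "fam S b = fam S b'"
  unfolding fam_def using assms
  by (intro restrict_ext numbered_space.graph_cong[OF space])

lemma fam_inject:
  assumes eq: "fam S b = fam S b'" and S: "S \<in> families"
    and ikl: "i \<in> {1..n}" "k \<in> S i" "l \<in> K i - S i"
  shows "b i k l = b' i k l"
proof (rule numbered_space.graph_inject[OF space[OF ikl(1)] _ _ ikl(2,3)])
  show "graphi i (S i) (b i) = graphi i (S i) (b' i)" using fun_cong[OF eq, of i] ikl by (simp add: fam_apply)
qed (use families_subset[OF S ikl(1)] in auto)

lemma fam_in_prod: "S \<in> families \<Longrightarrow> fam S b \<in> prod_grassmannian sc n V e"
  unfolding prod_grassmannian_def
proof (rule PiE_I)
  fix i assume S: "S \<in> families" and i: "i \<in> {1..n}"
  interpret ns: numbered_space sc "K i" "v i" using i by (rule space)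
  show "fam S b i \<in> grassmannian sc (e i) (V i)"
    unfolding grassmannian_def fam_apply[OF i] V_eq[OF i]
    using ns.subspace_graph ns.graph_subset ns.dim_graph[OF families_subset[OF S i]] families_card[OF S i]
    by auto
qed (auto simp: fam_def)

lemma prod_grassmannianD:
  assumes "N \<in> prod_grassmannian sc n V e" "i \<in> {1..n}"
  shows "subspace (N i)" "N i \<subseteq> span (v i ` K i)" "dim (N i) = e i"
proof -
  have "N i \<in> grassmannian sc (e i) (V i)"
    using assms unfolding prod_grassmannian_def by (rule PiE_mem)
  then show "subspace (N i)" "N i \<subseteq> span (v i ` K i)" "dim (N i) = e i"
    unfolding grassmannian_def V_eq[OF assms(2)] by auto
qed

lemma echelon_exists:
  assumes N: "N \<in> prod_grassmannian sc n V e"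
  shows "\<exists>S\<in>families. \<exists>b. upper S b \<and> N = fam S b"
proof -
  let ?P = "\<lambda>i S b. S \<subseteq> K i \<and> card S = e i \<and> N i = graphi i S b \<and> (\<forall>k\<in>S. \<forall>l\<in>K i - S. b k l \<noteq> 0 \<longrightarrow> k < l)"
  have "\<forall>i\<in>{1..n}. \<exists>p. ?P i (fst p) (snd p)"
  proof
    fix i assume i: "i \<in> {1..n}"
    interpret ns: numbered_space sc "K i" "v i" using i by (rule space)
    obtain S b where "?P i S b"
      using ns.exists_echelon[OF prod_grassmannianD(1,2)[OF N i]] prod_grassmannianD(3)[OF N i]
      by auto
    then show "\<exists>p. ?P i (fst p) (snd p)" by (intro exI[of _ "(S, b)"]) simp
  qed
  then obtain p where p: "\<forall>i\<in>{1..n}. ?P i (fst (p i)) (snd (p i))" by (rule bchoice[THEN exE])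
  define S b where "S i = fst (p i)" and "b i = snd (p i)" for i
  have Sb: "?P i (S i) (b i)" if "i \<in> {1..n}" for i
    using p that unfolding S_def b_def by (rule bspec)
  define S' where "S' = restrict S {1..n}"
  \<comment> \<open>Clearing the entries that the graph ignores achieves \<open>upper\<close>
    without changing the graph.\<close>
  define b' where "b' i k l = (if i \<in> {1..n} \<and> k \<in> S i \<and> l \<in> K i - S i then b i k l else 0)" for i k l
  have "S i \<in> {T. T \<subseteq> K i \<and> card T = e i}" if "i \<in> {1..n}" for i using Sb[OF that] by simp
  then have S': "S' \<in> families" unfolding S'_def families_def by (simp only: restrict_PiE_iff) (rule ballI)
  have "upper S' b'"
    unfolding upper_def
  proof (intro allI impI)
    fix i k l assume "b' i k l \<noteq> 0"
    then have *: "i \<in> {1..n}" "k \<in> S i" "l \<in> K i - S i" "b i k l \<noteq> 0"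
      unfolding b'_def by (auto split: if_splits)
    then have "k < l" using conjunct2[OF conjunct2[OF conjunct2[OF Sb[OF *(1)]]]] by simp
    then show "entry S' i k l" using * unfolding entry_def S'_def by simp
  qed
  moreover have "N = fam S' b'"
  proof
    fix i
    show "N i = fam S' b' i"
    proof (cases "i \<in> {1..n}")
      case True
      have "graphi i (S i) (b i) = graphi i (S i) (b' i)"
        using True by (intro numbered_space.graph_cong[OF space]) (auto simp: b'_def)
      moreover have "N i = graphi i (S i) (b i)" using Sb[OF True] by (elim conjE)
      ultimately show ?thesis using True by (simp only: fam_apply[OF True] S'_def restrict_apply' )
    next
      case False
      have "N i = undefined" using N False unfolding prod_grassmannian_def by (rule PiE_arb)
      then show ?thesis unfolding fam_def using False by auto
    qed
  qed
  ultimately show ?thesis using S' by blast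
qed

section \<open>Equations for subrepresentations\<close>

lemma coord_f_graph_vec:
  assumes S: "S \<in> families" and up: "upper S b" and i: "i \<in> {1..<n}" and k: "k \<in> S i" and l: "l \<in> K (Suc i)"
  shows "coordi (Suc i) (f i (graph_veci i (S i) (b i) k)) l = (if l = k then 1 else 0) + b i k l"
proof -
  interpret ns: numbered_space sc "K i" "v i" using i by (intro space) auto
  have i': "i \<in> {1..n}" using i by auto
  have "ns.graph_vec (S i) (b i) k \<in> V i"
    unfolding V_eq[OF i'] ns.graph_vec_def by (rule ns.comb_in_total)
  \<comment> \<open>By \<open>upper\<close>, \<open>b i k l\<close> vanishes for \<open>l\<close> in
    \<open>S i\<close> and for \<open>l\<close> outside \<open>K i\<close>, so one formula covers
    all cases.\<close>
  from coord_f[OF i this l] show ?thesis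
    using up k families_subset[OF S i'] unfolding upper_def entry_def
    by (auto simp: ns.coord_graph_vec)
qed

lemma step_iff:
  assumes S: "S \<in> families" and up: "upper S b" and i: "i \<in> {1..<n}"
  shows "f i ` graphi i (S i) (b i) \<subseteq> graphi (Suc i) (S (Suc i)) (b (Suc i)) \<longleftrightarrow>
    (\<forall>k\<in>S i. f i (graph_veci i (S i) (b i) k) \<in> graphi (Suc i) (S (Suc i)) (b (Suc i)))" (is "?L \<longleftrightarrow> ?R")
proof
  interpret ns: numbered_space sc "K i" "v i" using i by (intro space) auto
  interpret ns': numbered_space sc "K (Suc i)" "v (Suc i)" using i by (intro space) auto
  have i': "i \<in> {1..n}" using i by auto
  note SK = families_subset[OF S i']
  show "?L \<Longrightarrow> ?R" using ns.graph_vec_in_graph[OF SK] by auto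
  assume R: ?R
  show ?L
  proof
    fix y assume "y \<in> f i ` ns.graph (S i) (b i)"
    then obtain x where x: "x \<in> ns.graph (S i) (b i)" "y = f i x" by auto
    have "f i x = f i (\<Sum>k\<in>S i. sc (ns.coord x k) (ns.graph_vec (S i) (b i) k))"
      using ns.graph_expand[OF SK x(1)] by simp
    also have "\<dots> = (\<Sum>k\<in>S i. sc (ns.coord x k) (f i (ns.graph_vec (S i) (b i) k)))"
      by (rule f_lincomb[OF i]) (simp add: V_eq[OF i'] ns.graph_vec_def)
    also have "\<dots> \<in> ns'.graph (S (Suc i)) (b (Suc i))"
      using R by (intro subspace_sum subspace_scale ns'.subspace_graph) auto
    finally show "y \<in> ns'.graph (S (Suc i)) (b (Suc i))" using x by simp
  qed
qed

lemma quiver_grassmannian_iff_step: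
  assumes "S \<in> families"
  shows "fam S b \<in> quiver_grassmannian sc n V f e \<longleftrightarrow>
    (\<forall>i\<in>{1..<n}. f i ` graphi i (S i) (b i) \<subseteq> graphi (Suc i) (S (Suc i)) (b (Suc i)))"
  using fam_in_prod[OF assms] unfolding quiver_grassmannian_def by (auto simp: fam_apply)

text \<open>The image of the \<open>k\<close>-th echelon vector has leading index \<open>k\<close>, unless it vanishes.\<close>

lemma compatible_if_subrep:
  assumes S: "S \<in> families" and up: "upper S b" and X: "fam S b \<in> quiver_grassmannian sc n V f e"
  shows "compatible S"
  unfolding compatible_def
proof (intro ballI subsetI, rule ccontr)
  fix i k assume i: "i \<in> {1..<n}" and k: "k \<in> S i \<inter> K (Suc i)" and kS: "k \<notin> S (Suc i)"
  interpret ns': numbered_space sc "K (Suc i)" "v (Suc i)" using i by (intro space) auto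
  let ?y = "f i (graph_veci i (S i) (b i) k)"
  have "?y \<in> ns'.graph (S (Suc i)) (b (Suc i))"
    using X i k step_iff[OF S up i] quiver_grassmannian_iff_step[OF S] by blast
  then have "ns'.coord ?y k = (\<Sum>j\<in>S (Suc i). ns'.coord ?y j * b (Suc i) j k)"
    unfolding ns'.graph_def using k kS by blast
  \<comment> \<open>A nonzero summand would need \<open>j < k\<close> for the matrix entry and
    \<open>k \<le> j\<close> for the coordinate of the image.\<close>
  moreover have "ns'.coord ?y j * b (Suc i) j k = 0" if j: "j \<in> S (Suc i)" for j
  proof (rule ccontr)
    assume nz: "ns'.coord ?y j * b (Suc i) j k \<noteq> 0"
    have jK: "j \<in> K (Suc i)" using families_subset[OF S, of "Suc i"] i j by auto
    have "j < k" using nz up unfolding upper_def entry_def by auto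
    moreover have "b i k j \<noteq> 0 \<or> j = k"
      using nz coord_f_graph_vec[OF S up i _ jK, of k] k by (auto split: if_splits)
    then have "k < j \<or> j = k" using up unfolding upper_def entry_def by blast
    ultimately show False by auto
  qed
  ultimately have "ns'.coord ?y k = 0" by simp
  moreover have "b i k k = 0" using up unfolding upper_def entry_def by blast
  ultimately show False using coord_f_graph_vec[OF S up i, of k k] k by simp
qed

text \<open>It suffices to test the images of the graph vectors. If \<open>k\<close> persists at the
  next vertex, comparing coordinates gives the relation. If \<open>k\<close> ends, all larger
  indices end as well, the image is zero, and there is no condition.\<close>

lemma subrep_iff_relations:
  assumes S: "S \<in> families" and up: "upper S b" and comp: "compatible S"
  shows "fam S b \<in> quiver_grassmannian sc n V f e \<longleftrightarrow> relations S b"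
proof -
  have "f i (graph_veci i (S i) (b i) k) \<in> graphi (Suc i) (S (Suc i)) (b (Suc i)) \<longleftrightarrow>
      (k \<in> K (Suc i) \<longrightarrow> (\<forall>l\<in>K (Suc i) - S (Suc i).
        b i k l = b (Suc i) k l + (\<Sum>j\<in>S (Suc i). b i k j * b (Suc i) j l)))" (is "?L \<longleftrightarrow> ?R")
    if i: "i \<in> {1..<n}" and k: "k \<in> S i" for i k
  proof -
    interpret ns: numbered_space sc "K i" "v i" using i by (intro space) auto
    interpret ns': numbered_space sc "K (Suc i)" "v (Suc i)" using i by (intro space) auto
    have i': "i \<in> {1..n}" "Suc i \<in> {1..n}" using i by auto
    let ?y = "f i (ns.graph_vec (S i) (b i) k)"
    note c = coord_f_graph_vec[OF S up i k]
    have "ns.graph_vec (S i) (b i) k \<in> V i"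
      unfolding V_eq[OF i'(1)] ns.graph_vec_def by (rule ns.comb_in_total)
    then have yV: "?y \<in> ns'.total" using f_in_V[OF i] V_eq[OF i'(2)] by blast
    have SK: "S (Suc i) \<subseteq> K (Suc i)" by (rule families_subset[OF S i'(2)])
    show ?thesis
    proof (cases "k \<in> K (Suc i)")
      case True
      then have kS: "k \<in> S (Suc i)" using comp i k unfolding compatible_def by blast
      have fin: "finite (S (Suc i))" using SK ns'.finite_K finite_subset by blast
      have "ns'.coord ?y l = b i k l" if "l \<in> K (Suc i) - S (Suc i)" for l
        using c[of l] that kS by auto
      moreover have "(\<Sum>j\<in>S (Suc i). ns'.coord ?y j * b (Suc i) j l)
          = b (Suc i) k l + (\<Sum>j\<in>S (Suc i). b i k j * b (Suc i) j l)" for l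
      proof -
        \<comment> \<open>The coordinate 1 at the pivot \<open>k\<close> contributes the linear
          term.\<close>
        have "(\<Sum>j\<in>S (Suc i). ns'.coord ?y j * b (Suc i) j l)
            = (\<Sum>j\<in>S (Suc i). (if j = k then b (Suc i) k l else 0) + b i k j * b (Suc i) j l)"
          using c SK by (intro sum.cong) (auto simp: algebra_simps)
        then show ?thesis using kS fin by (simp add: sum.distrib)
      qed
      ultimately show ?thesis unfolding ns'.graph_def using yV True by simp
    next
      case False
      have "k \<in> K i" using families_subset[OF S i'(1)] k by auto
      have "?y = 0"
      proof (rule ns'.total_eqI[OF yV span_zero])
        fix l assume l: "l \<in> K (Suc i)"
        have "b i k l = 0"
        proof (rule ccontr)
          assume "b i k l \<noteq> 0"
          then have "entry S i k l" using up unfolding upper_def by blast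
          then have "l \<in> K i" "k < l" unfolding entry_def by auto
          from kernel_upward[OF i \<open>k \<in> K i\<close> False this] l show False by blast
        qed
        then show "ns'.coord ?y l = ns'.coord 0 l" using c[OF l] l False by auto
      qed
      then have ?L using subspace_0[OF ns'.subspace_graph] by simp
      then show ?thesis using False by blast
    qed
  qed
  then show ?thesis
    unfolding quiver_grassmannian_iff_step[OF S] relations_def
    using step_iff[OF S up] by (auto simp: Ball_def)
qed

subsection \<open>Charts\<close>

definition enum :: "(nat \<Rightarrow> nat set) \<Rightarrow> nat \<Rightarrow> nat \<Rightarrow> nat" where
  "enum S i = (SOME s. bij_betw s {..<e i} (S i))"

definition frame_minor :: "(nat \<Rightarrow> nat set) \<Rightarrow> (nat \<times> nat \<times> nat \<Rightarrow> complex) \<Rightarrow> nat \<Rightarrow> complex" where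
  "frame_minor S A i = numbered_space.minor (e i) (enum S i) (\<lambda>c k. A (i, c, k))"

definition frame_num :: "(nat \<Rightarrow> nat set) \<Rightarrow> (nat \<times> nat \<times> nat \<Rightarrow> complex) \<Rightarrow> nat \<Rightarrow> nat \<Rightarrow> nat \<Rightarrow> complex" where
  "frame_num S A i k l = numbered_space.cramer_num (e i) (enum S i) (\<lambda>c k. A (i, c, k)) k l"

text \<open>No echelon condition is imposed: for a family \<open>S\<close> this is the open set of
  tuples projecting bijectively to the coordinates in \<open>S i\<close> at every vertex.\<close>

definition chart :: "(nat \<Rightarrow> nat set) \<Rightarrow> (nat \<Rightarrow> 'v set) set" where
  "chart S = range (fam S)"

text \<open>The normalized frame with an identity matrix in the pivot rows; it gives a section of
  the quotient map over the chart whose entries are constants or entries of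
  \<open>b\<close>.\<close>

definition frame_mat :: "(nat \<Rightarrow> nat set) \<Rightarrow> (nat \<Rightarrow> nat \<Rightarrow> nat \<Rightarrow> complex) \<Rightarrow> nat \<times> nat \<times> nat \<Rightarrow> complex" where
  "frame_mat S b = (\<lambda>(i, c, k). if i \<in> {1..n} \<and> c < e i \<and> k \<in> K i then
     (if k \<in> S i then (if k = enum S i c then 1 else 0) else b i (enum S i c) k) else 0)"

lemma enum:
  assumes "S \<in> families" "i \<in> {1..n}" shows "bij_betw (enum S i) {..<e i} (S i)"
proof -
  have "finite (S i)" using families_subset[OF assms] finite_K[OF assms(2)] finite_subset by blast
  then have "\<exists>s. bij_betw s {..<e i} (S i)"
    using ex_bij_betw_nat_finite[of "S i"] families_card[OF assms] by (simp add: lessThan_atLeast0)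
  then show ?thesis unfolding enum_def by (rule someI_ex)
qed

lemma frame_span_apply:
  "i \<in> {1..n} \<Longrightarrow> frame_span sc n K v e A i =
     span ((\<lambda>c. numbered_space.comb sc (K i) (v i) (\<lambda>k. A (i, c, k))) ` {..<e i})"
  unfolding frame_span_def numbered_space.comb_def[OF space] by simp

lemma framesD: "A \<in> frames sc n V K v e \<Longrightarrow> frame_span sc n K v e A \<in> prod_grassmannian sc n V e"
  unfolding frames_def by blast

lemma frame_dim:
  assumes "A \<in> frames sc n V K v e" "i \<in> {1..n}"
  shows "dim (span ((\<lambda>c. numbered_space.comb sc (K i) (v i) (\<lambda>k. A (i, c, k))) ` {..<e i})) = e i"
  using prod_grassmannianD(3)[OF framesD[OF assms(1)] assms(2)] unfolding frame_span_apply[OF assms(2)] .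

lemma frame_span_chart:
  assumes S: "S \<in> families" and A: "A \<in> frames sc n V K v e"
    and nz: "\<And>i. i \<in> {1..n} \<Longrightarrow> frame_minor S A i \<noteq> 0"
  shows "frame_span sc n K v e A = fam S (\<lambda>i k l. frame_num S A i k l / frame_minor S A i)"
proof
  fix i
  show "frame_span sc n K v e A i = fam S (\<lambda>i k l. frame_num S A i k l / frame_minor S A i) i"
  proof (cases "i \<in> {1..n}")
    case True
    show ?thesis
      unfolding frame_span_apply[OF True] fam_apply[OF True] frame_num_def frame_minor_def
      by (rule numbered_space.col_span_eq_graph[OF space[OF True] families_subset[OF S True] enum[OF S True]
            frame_dim[OF A True] nz[OF True, unfolded frame_minor_def]])
  next
    case False
    then show ?thesis unfolding frame_span_def fam_def by auto
  qed
qed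

lemma frame_minor_nonzero:
  assumes S: "S \<in> families" and A: "A \<in> frames sc n V K v e" and i: "i \<in> {1..n}"
    and eq: "frame_span sc n K v e A = fam S b"
  shows "frame_minor S A i \<noteq> 0"
proof -
  interpret ns: numbered_space sc "K i" "v i" using i by (rule space)
  have "ns.col_span (e i) (\<lambda>c k. A (i, c, k)) = ns.graph (S i) (b i)"
    using fun_cong[OF eq, of i] unfolding frame_span_apply[OF i] fam_apply[OF i] .
  then show ?thesis
    unfolding frame_minor_def
      ns.minor_nonzero_iff[OF families_subset[OF S i] enum[OF S i] frame_dim[OF A i]]
    using ns.in_chart_graph by simp
qed

text \<open>The quotient depends on the frame only through its span, because a graph determines its
  matrix.\<close>

lemma coeff_frame:
  assumes S: "S \<in> families" and A: "A \<in> frames sc n V K v e"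
    and eq: "frame_span sc n K v e A = fam S b" and ikl: "i \<in> {1..n}" "k \<in> S i" "l \<in> K i - S i"
  shows "frame_num S A i k l / frame_minor S A i = b i k l"
proof -
  have "fam S (\<lambda>i k l. frame_num S A i k l / frame_minor S A i) = fam S b"
    using frame_span_chart[OF S A frame_minor_nonzero[OF S A _ eq]] eq by simp
  from fam_inject[OF this S ikl] show ?thesis .
qed

lemma frame_mat:
  assumes S: "S \<in> families"
  shows "frame_mat S b \<in> frames sc n V K v e" "frame_span sc n K v e (frame_mat S b) = fam S b"
proof -
  show eq: "frame_span sc n K v e (frame_mat S b) = fam S b"
  proof
    fix i
    show "frame_span sc n K v e (frame_mat S b) i = fam S b i"
    proof (cases "i \<in> {1..n}")
      case i: True
      interpret ns: numbered_space sc "K i" "v i" using i by (rule space)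
      have s: "bij_betw (enum S i) {..<e i} (S i)" by (rule enum[OF S i])
      have "ns.comb (\<lambda>k. frame_mat S b (i, c, k)) = ns.graph_vec (S i) (b i) (enum S i c)"
        if "c < e i" for c
        unfolding ns.graph_vec_def using that i by (intro ns.comb_cong) (simp add: frame_mat_def)
      then have "(\<lambda>c. ns.comb (\<lambda>k. frame_mat S b (i, c, k))) ` {..<e i}
          = (\<lambda>c. ns.graph_vec (S i) (b i) (enum S i c)) ` {..<e i}"
        by (intro image_cong) auto
      also have "\<dots> = ns.graph_vec (S i) (b i) ` S i"
        using s unfolding bij_betw_def by (metis image_image)
      finally show ?thesis
        unfolding frame_span_apply[OF i] fam_apply[OF i] ns.graph_eq_span[OF families_subset[OF S i]] by simp
    next
      case False
      then show ?thesis unfolding frame_span_def fam_def by auto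
    qed
  qed
  show "frame_mat S b \<in> frames sc n V K v e"
    unfolding frames_def mem_Collect_eq eq using fam_in_prod[OF S] by (auto simp: frame_mat_def)
qed

lemma polyfun_frame_minor:
  assumes i: "i \<in> {1..n}" shows "(\<lambda>A. frame_minor S A i) \<in> polyfun"
  unfolding frame_minor_def numbered_space.minor_def[OF space[OF i]]
  by (intro polyfun_det_fun polyfun.coord)

lemma polyfun_frame_num:
  assumes i: "i \<in> {1..n}" shows "(\<lambda>A. frame_num S A i k l) \<in> polyfun"
  unfolding frame_num_def numbered_space.cramer_num_def[OF space[OF i]]
proof (intro polyfun_sum polyfun.mult polyfun_det_fun polyfun.coord)
  fix c r j
  show "(\<lambda>A. if j = c then if enum S i r = k then 1 else 0 else A (i, j, enum S i r)) \<in> polyfun"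
    by (cases "j = c") (simp_all add: polyfun.const polyfun.coord)
qed

lemma chart_iff:
  assumes "S \<in> families" "A \<in> frames sc n V K v e"
  shows "frame_span sc n K v e A \<in> chart S \<longleftrightarrow> (\<forall>i\<in>{1..n}. frame_minor S A i \<noteq> 0)"
proof
  assume "frame_span sc n K v e A \<in> chart S"
  then obtain b where "frame_span sc n K v e A = fam S b" unfolding chart_def by auto
  from frame_minor_nonzero[OF assms _ this] show "\<forall>i\<in>{1..n}. frame_minor S A i \<noteq> 0" by blast
next
  assume "\<forall>i\<in>{1..n}. frame_minor S A i \<noteq> 0"
  then show "frame_span sc n K v e A \<in> chart S"
    unfolding chart_def using frame_span_chart[OF assms] by blast
qed

text \<open>On frames a single polynomial, the product of the minors over all vertices, cuts out the
  complement.\<close>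

lemma openin_chart:
  assumes S: "S \<in> families" shows "openin (grass_zariski sc n V K v e) (chart S)"
  unfolding grass_zariski_def openin_quotient_topology topspace_zariski
proof
  show "chart S \<subseteq> prod_grassmannian sc n V e" unfolding chart_def using fam_in_prod[OF S] by auto
  have "{A \<in> frames sc n V K v e. frame_span sc n K v e A \<in> chart S}
      = {A \<in> frames sc n V K v e. (\<Prod>i\<in>{1..n}. frame_minor S A i) \<noteq> 0}"
    using chart_iff[OF S] by auto
  also have "openin (zariski (frames sc n V K v e)) \<dots>"
    by (intro openin_zariski_nonzero polyfun_prod polyfun_frame_minor)
  finally show "openin (zariski (frames sc n V K v e)) {A \<in> frames sc n V K v e. frame_span sc n K v e A \<in> chart S}" .
qed

subsection \<open>The cells are affine spaces\<close>

definition cell :: "(nat \<Rightarrow> nat set) \<Rightarrow> (nat \<Rightarrow> 'v set) set" where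
  "cell S = {N \<in> quiver_grassmannian sc n V f e. \<exists>b. upper S b \<and> N = fam S b}"

text \<open>The number of these positions is the dimension of the cell. The guard
  \<open>1 < i\<close> makes all entries at vertex 1 free, since no vertex precedes it.\<close>

definition free :: "(nat \<Rightarrow> nat set) \<Rightarrow> (nat \<times> nat \<times> nat) set" where
  "free S = {(i, k, l). entry S i k l \<and> \<not> (1 < i \<and> k \<in> S (i - 1))}"

abbreviation "sol S \<equiv> solve S (entry S)"

lemma finite_free: "S \<in> families \<Longrightarrow> finite (free S)"
proof (rule finite_subset)
  assume S: "S \<in> families"
  show "free S \<subseteq> (SIGMA i:{1..n}. K i \<times> K i)"
    unfolding free_def entry_def using families_subset[OF S] by auto
  show "finite (SIGMA i:{1..n}. K i \<times> K i)" using finite_K by auto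
qed

lemma upper_sol: "upper S (sol S x)"
  unfolding upper_def using solve_eq_0[of "entry S"] by metis

text \<open>Reconciles the sum over all pivots in \<open>relations\<close> with the truncated sum
  that makes \<open>solve\<close> terminate.\<close>

lemma upper_sum:
  assumes up: "upper S b" and S: "S \<in> families" and i: "i \<in> {1..n}"
  shows "(\<Sum>j\<in>S i. b i' k j * b i j l) = (\<Sum>j\<in>{j \<in> S i. k < j \<and> j < l}. b i' k j * b i j l)"
proof (rule sum.mono_neutral_right)
  show "finite (S i)" using families_subset[OF S i] finite_K[OF i] finite_subset by blast
  show "\<forall>j\<in>S i - {j \<in> S i. k < j \<and> j < l}. b i' k j * b i j l = 0"
  proof (rule ballI, rule ccontr)
    fix j assume j: "j \<in> S i - {j \<in> S i. k < j \<and> j < l}" "b i' k j * b i j l \<noteq> 0"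
    then have "entry S i' k j" "entry S i j l" using up unfolding upper_def by auto
    then show False using j(1) unfolding entry_def by auto
  qed
qed auto

text \<open>The recursive branch of \<open>solve\<close> is the relation solved for the entry at the
  later vertex; for \<open>l \<le> k\<close> both sides vanish.\<close>

lemma relations_sol:
  assumes S: "S \<in> families" and comp: "compatible S"
  shows "relations S (sol S x)"
  unfolding relations_def
proof (intro ballI)
  fix i k l assume i: "i \<in> {1..<n}" and k: "k \<in> S i \<inter> K (Suc i)" and l: "l \<in> K (Suc i) - S (Suc i)"
  have i': "Suc i \<in> {1..n}" using i by auto
  have kS: "k \<in> S (Suc i)" using comp i k unfolding compatible_def by blast
  show "sol S x i k l = sol S x (Suc i) k l + (\<Sum>j\<in>S (Suc i). sol S x i k j * sol S x (Suc i) j l)"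
    unfolding upper_sum[OF upper_sol S i']
  proof (cases "k < l")
    case True
    then have "entry S (Suc i) k l" unfolding entry_def using i' kS l by simp
    moreover have "1 < Suc i \<and> k \<in> S (Suc i - 1)" using i k by auto
    ultimately have "sol S x (Suc i) k l = sol S x i k l -
      (\<Sum>j\<in>{j \<in> S (Suc i). k < j \<and> j < l}. sol S x i k j * sol S x (Suc i) j l)"
      by (subst solve.simps) simp
    then show "sol S x i k l = sol S x (Suc i) k l +
      (\<Sum>j\<in>{j \<in> S (Suc i). k < j \<and> j < l}. sol S x i k j * sol S x (Suc i) j l)" by simp
  next
    case False
    then have "\<not> entry S i k l" "\<not> entry S (Suc i) k l" unfolding entry_def by auto
    moreover have "{j \<in> S (Suc i). k < j \<and> j < l} = {}" using False by auto
    ultimately show "sol S x i k l = sol S x (Suc i) k l +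
      (\<Sum>j\<in>{j \<in> S (Suc i). k < j \<and> j < l}. sol S x i k j * sol S x (Suc i) j l)"
      by (simp only: solve_eq_0 not_False_eq_True sum.empty add_0_right)
  qed
qed

text \<open>The nested induction, on the vertex and then on \<open>l - k\<close>, follows the
  termination order of \<open>solve\<close>.\<close>

lemma sol_unique:
  assumes S: "S \<in> families" and up: "upper S b" and r: "relations S b"
    and x: "\<And>i k l. (i, k, l) \<in> free S \<Longrightarrow> x i k l = b i k l"
  shows "sol S x i k l = b i k l"
proof (induction i arbitrary: k l rule: less_induct)
  case outer: (less i)
  show ?case
  proof (induction "l - k" arbitrary: k l rule: less_induct)
    case inner: less
    show ?case
    proof (cases "entry S i k l")
      case ent: True
      then have i: "i \<in> {1..n}" and k: "k \<in> S i" and l: "l \<in> K i - S i" "k < l"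
        unfolding entry_def by auto
      show ?thesis
      proof (cases "1 < i \<and> k \<in> S (i - 1)")
        case True
        have *: "sol S x i k l = sol S x (i - 1) k l -
            (\<Sum>j\<in>{j \<in> S i. k < j \<and> j < l}. sol S x (i - 1) k j * sol S x i j l)"
          using ent True by (subst solve.simps) simp
        have "i - 1 < i" using True by simp
        note IH = outer[OF this]
        have "(\<Sum>j\<in>{j \<in> S i. k < j \<and> j < l}. sol S x (i - 1) k j * sol S x i j l)
            = (\<Sum>j\<in>{j \<in> S i. k < j \<and> j < l}. b (i - 1) k j * b i j l)"
        proof (rule sum.cong[OF refl])
          fix j assume "j \<in> {j \<in> S i. k < j \<and> j < l}"
          then have "l - j < l - k" by auto
          then show "sol S x (i - 1) k j * sol S x i j l = b (i - 1) k j * b i j l"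
            using IH[of k j] inner[of l j] by simp
        qed
        also have "\<dots> = (\<Sum>j\<in>S i. b (i - 1) k j * b i j l)"
          by (rule upper_sum[OF up S i, symmetric])
        finally have "sol S x i k l = b (i - 1) k l - (\<Sum>j\<in>S i. b (i - 1) k j * b i j l)"
          using * IH by simp
        moreover have "b (i - 1) k l = b i k l + (\<Sum>j\<in>S i. b (i - 1) k j * b i j l)"
        proof -
          have i1: "i - 1 \<in> {1..<n}" "Suc (i - 1) = i" using True i by auto
          have "k \<in> S (i - 1) \<inter> K (Suc (i - 1))" using families_subset[OF S i] k True i1(2) by auto
          moreover have "l \<in> K (Suc (i - 1)) - S (Suc (i - 1))" using l(1) i1(2) by simp
          ultimately have "b (i - 1) k l = b (Suc (i - 1)) k l +
              (\<Sum>j\<in>S (Suc (i - 1)). b (i - 1) k j * b (Suc (i - 1)) j l)"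
            using r i1(1) unfolding relations_def by (elim ballE) auto
          then show ?thesis unfolding i1(2) .
        qed
        ultimately show ?thesis by simp
      next
        case False
        then show ?thesis using ent x[of i k l] solve_free[of "entry S"] unfolding free_def by simp
      qed
    next
      case False
      then have "b i k l = 0" using up unfolding upper_def by blast
      with False show ?thesis by (simp only: solve_eq_0 not_False_eq_True)
    qed
  qed
qed

lemma fam_sol_in_cell:
  assumes S: "S \<in> families" and comp: "compatible S"
  shows "fam S (sol S x) \<in> cell S"
  unfolding cell_def using subrep_iff_relations[OF S upper_sol comp] relations_sol[OF S comp] upper_sol
  by blast

text \<open>Free coordinates are completed by \<open>solve\<close> and written as a normalized
  frame, which is polynomial. The inverse reads off the matrix entries at the free positions, which
  are quotients of determinants.\<close>

lemma is_affine_cell_cell: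
  assumes S: "S \<in> families" and comp: "compatible S"
  shows "is_affine_cell sc n V K v e (cell S)"
proof -
  let ?F = "frames sc n V K v e" and ?\<pi> = "frame_span sc n K v e"
  define d where "d = card (free S)"
  obtain en where en: "bij_betw en {..<d} (free S)"
    using ex_bij_betw_nat_finite[OF finite_free[OF S]] unfolding d_def by (auto simp: lessThan_atLeast0)
  define asg where "asg y i k l = (if (i, k, l) \<in> free S then y (inv_into {..<d} en (i, k, l)) else 0)"
    for y :: "nat \<Rightarrow> complex" and i k l
  define \<psi> where "\<psi> y = frame_mat S (sol S (asg y))" for y
  \<comment> \<open>This is meaningful on the whole chart and not only over the cell, as the open
    neighbourhood in the criterion demands.\<close>
  define \<rho> where "\<rho> A j = (if j < d then (case en j of (i, k, l) \<Rightarrow> frame_num S A i k l / frame_minor S A i) else 0)"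
    for A and j :: nat
  have free_entry: "i \<in> {1..n}" "k \<in> S i" "l \<in> K i - S i" if "(i, k, l) \<in> free S" for i k l
    using that unfolding free_def entry_def by auto
  have \<rho>fam: "\<rho> A j = (if j < d then (case en j of (i, k, l) \<Rightarrow> b i k l) else 0)"
    if A: "A \<in> ?F" and eq: "?\<pi> A = fam S b" for A b j
  proof (cases "j < d")
    case True
    obtain i k l where ikl: "en j = (i, k, l)" by (cases "en j") auto
    then have "(i, k, l) \<in> free S" using bij_betw_apply[OF en, of j] True by simp
    from coeff_frame[OF S A eq free_entry[OF this]] show ?thesis
      using True ikl by (simp add: \<rho>_def)
  qed (simp add: \<rho>_def)
  have "variety_iso (zariski (affine_space d)) regular_on
     (subtopology (quotient_topology (zariski ?F) ?\<pi> (prod_grassmannian sc n V e)) (cell S))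
     (\<lambda>W h. regular_on {A \<in> ?F. ?\<pi> A \<in> W} (h \<circ> ?\<pi>)) (?\<pi> \<circ> \<psi>)"
  proof (rule variety_iso_quotientI[where U = "chart S" and \<rho> = \<rho>])
    show "openin (quotient_topology (zariski ?F) ?\<pi> (prod_grassmannian sc n V e)) (chart S)"
      using openin_chart[OF S] unfolding grass_zariski_def .
    show "cell S \<subseteq> chart S" unfolding cell_def chart_def by auto
    show "\<exists>A\<in>?F. ?\<pi> A = N" if "N \<in> chart S" for N
      using that frame_mat[OF S] unfolding chart_def by blast
    show "(\<lambda>x. \<psi> x j) \<in> polyfun" for j
    proof -
      obtain i c k where j: "j = (i, c, k)" by (cases j) auto
      have "(\<lambda>x. asg x i k l) \<in> polyfun" for i k l
        by (cases "(i, k, l) \<in> free S") (simp_all add: asg_def polyfun.const polyfun.coord)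
      then have "(\<lambda>x. sol S (asg x) i k l) \<in> polyfun" for i k l by (rule polyfun_solve)
      then show ?thesis
        unfolding \<psi>_def frame_mat_def j
        by (cases "i \<in> {1..n} \<and> c < e i \<and> k \<in> K i"; cases "k \<in> S i") (auto simp: polyfun.const)
    qed
    show "\<psi> x \<in> ?F \<and> ?\<pi> (\<psi> x) \<in> cell S" for x
      unfolding \<psi>_def using frame_mat[OF S] fam_sol_in_cell[OF S comp] by simp
    show "(\<lambda>A. \<rho> A j) \<in> ratfun {A \<in> ?F. ?\<pi> A \<in> chart S}" for j
    proof (cases "j < d")
      case True
      obtain i k l where ikl: "en j = (i, k, l)" by (cases "en j") auto
      then have "(i, k, l) \<in> free S" using bij_betw_apply[OF en, of j] True by simp
      then have "i \<in> {1..n}" by (rule free_entry)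
      then show ?thesis
        using True ikl chart_iff[OF S]
        by (intro ratfunI[OF polyfun_frame_num[of i S k l] polyfun_frame_minor[of i S]]) (auto simp: \<rho>_def)
    next
      case False
      then have "(\<lambda>A. \<rho> A j) = (\<lambda>A. 0)" by (auto simp: \<rho>_def)
      then show ?thesis by (simp only: polyfun_ratfun polyfun.const)
    qed
    show "\<rho> A \<in> affine_space d" for A unfolding affine_space_def \<rho>_def by simp
    show "\<rho> A = \<rho> A'" if A: "A \<in> ?F" "A' \<in> ?F" "?\<pi> A \<in> chart S" "?\<pi> A = ?\<pi> A'" for A A'
    proof -
      obtain b where "?\<pi> A = fam S b" using A(3) unfolding chart_def by auto
      then show ?thesis using \<rho>fam[OF A(1), of b] \<rho>fam[OF A(2), of b] A(4) by (intro ext) simp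
    qed
    show "\<rho> (\<psi> x) = x" if x: "x \<in> affine_space d" for x
    proof
      fix j
      show "\<rho> (\<psi> x) j = x j"
      proof (cases "j < d")
        case True
        obtain i k l where ikl: "en j = (i, k, l)" by (cases "en j") auto
        then have fr: "(i, k, l) \<in> free S" using bij_betw_apply[OF en, of j] True by simp
        have "\<rho> (\<psi> x) j = sol S (asg x) i k l"
          using \<rho>fam[OF frame_mat[OF S], of "sol S (asg x)" j] True ikl unfolding \<psi>_def by simp
        also have "\<dots> = asg x i k l"
          using fr unfolding free_def by (intro solve_free) auto
        also have "\<dots> = x (inv_into {..<d} en (en j))" using fr ikl by (simp add: asg_def)
        also have "\<dots> = x j" using True en by (subst inv_into_f_f) (auto simp: bij_betw_def)
        finally show ?thesis .
      next
        case False
        then show ?thesis using x unfolding affine_space_def \<rho>_def by simp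
      qed
    qed
    show "?\<pi> (\<psi> (\<rho> A)) = ?\<pi> A" if A: "A \<in> ?F" "?\<pi> A \<in> cell S" for A
    proof -
      obtain b where b: "upper S b" "?\<pi> A = fam S b" using A(2) unfolding cell_def by auto
      have r: "relations S b"
        using A(2) subrep_iff_relations[OF S b(1) comp] b(2) unfolding cell_def by simp
      have "asg (\<rho> A) i k l = b i k l" if fr: "(i, k, l) \<in> free S" for i k l
      proof -
        let ?j = "inv_into {..<d} en (i, k, l)"
        have "(i, k, l) \<in> en ` {..<d}" using en fr by (simp add: bij_betw_def)
        then have "?j < d" "en ?j = (i, k, l)"
          using inv_into_into[of "(i, k, l)" en "{..<d}"] f_inv_into_f[of "(i, k, l)" en "{..<d}"] by simp_all
        then show ?thesis using \<rho>fam[OF A(1) b(2), of ?j] fr by (simp add: asg_def)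
      qed
      \<comment> \<open>Discarding the other entries loses nothing on the cell, since the relations
        recover them.\<close>
      from sol_unique[OF S b(1) r this] have "sol S (asg (\<rho> A)) = b" by (intro ext) blast
      then show ?thesis unfolding \<psi>_def frame_mat(2)[OF S] b(2) by simp
    qed
  qed
  moreover have "grass_regular_on sc n V K v e = (\<lambda>W h. regular_on {A \<in> ?F. ?\<pi> A \<in> W} (h \<circ> ?\<pi>))"
    by (intro ext) (simp add: grass_regular_on_def)
  ultimately show ?thesis unfolding is_affine_cell_def grass_zariski_def by auto
qed

subsection \<open>Limits of the torus action\<close>

definition point :: "(nat \<Rightarrow> nat set) \<Rightarrow> nat \<Rightarrow> 'v set" where
  "point S = fam S (\<lambda>i k l. 0)"

text \<open>A quotient of powers rather than \<open>t ^ (l - k)\<close>: natural subtraction would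
  hide the negative exponents for \<open>l < k\<close>, which are what limits detect.\<close>

definition twist :: "complex \<Rightarrow> (nat \<Rightarrow> nat \<Rightarrow> nat \<Rightarrow> complex) \<Rightarrow> nat \<Rightarrow> nat \<Rightarrow> nat \<Rightarrow> complex" where
  "twist t b i k l = t ^ l / t ^ k * b i k l"

lemma torus_act_apply:
  assumes i: "i \<in> {1..n}"
  shows "torus_act sc n K v t N i = numbered_space.scale_vec sc (K i) (v i) t ` N i"
proof -
  interpret ns: numbered_space sc "K i" "v i" using i by (rule space)
  have "torus_act_vec sc K v t i = ns.scale_vec t"
    by (intro ext) (simp add: torus_act_vec_def ns.scale_vec_def ns.comb_def ns.coord_def)
  then show ?thesis using i unfolding torus_act_def by simp
qed

lemma torus_act_fam:
  assumes S: "S \<in> families" and t: "t \<noteq> 0"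
  shows "torus_act sc n K v t (fam S b) = fam S (twist t b)"
proof
  fix i
  show "torus_act sc n K v t (fam S b) i = fam S (twist t b) i"
  proof (cases "i \<in> {1..n}")
    case True
    have "twist t b i = (\<lambda>k l. t ^ l / t ^ k * b i k l)" by (intro ext) (simp add: twist_def)
    then show ?thesis
      unfolding torus_act_apply[OF True] fam_apply[OF True]
      using numbered_space.scale_vec_graph[OF space[OF True] t families_subset[OF S True]] by simp
  next
    case False
    then show ?thesis unfolding torus_act_def fam_def by auto
  qed
qed

lemma torus_act_inverse:
  assumes N: "N \<in> prod_grassmannian sc n V e" and t: "t \<noteq> 0"
  shows "torus_act sc n K v (1 / t) (torus_act sc n K v t N) = N"
proof -
  obtain S b where S: "S \<in> families" "N = fam S b" using echelon_exists[OF N] by blast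
  have "twist (1 / t) (twist t b) = b" using t by (intro ext) (simp add: twist_def power_divide)
  then show ?thesis unfolding S(2) using torus_act_fam[OF S(1)] t by simp
qed

text \<open>The relations are homogeneous: the weights \<open>j - k\<close> and \<open>l - j\<close>
  of the two factors in each product add up to \<open>l - k\<close>.\<close>

lemma relations_twist:
  assumes "relations S b" "t \<noteq> 0" shows "relations S (twist t b)"
  unfolding relations_def
proof (intro ballI)
  fix i k l assume ikl: "i \<in> {1..<n}" "k \<in> S i \<inter> K (Suc i)" "l \<in> K (Suc i) - S (Suc i)"
  have "b i k l = b (Suc i) k l + (\<Sum>j\<in>S (Suc i). b i k j * b (Suc i) j l)"
    using assms(1) ikl unfolding relations_def by blast
  then have "twist t b i k l = twist t b (Suc i) k l
      + (\<Sum>j\<in>S (Suc i). t ^ l / t ^ k * (b i k j * b (Suc i) j l))"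
    unfolding twist_def by (simp add: distrib_left sum_distrib_left)
  also have "(\<Sum>j\<in>S (Suc i). t ^ l / t ^ k * (b i k j * b (Suc i) j l))
      = (\<Sum>j\<in>S (Suc i). twist t b i k j * twist t b (Suc i) j l)"
    using assms(2) by (intro sum.cong) (auto simp: twist_def)
  finally show "twist t b i k l = twist t b (Suc i) k l
      + (\<Sum>j\<in>S (Suc i). twist t b i k j * twist t b (Suc i) j l)" .
qed

lemma upper_twist: "upper S b \<Longrightarrow> upper S (twist t b)"
  unfolding upper_def twist_def by auto

lemma torus_act_quiver_grassmannian:
  assumes N: "N \<in> quiver_grassmannian sc n V f e" and t: "t \<noteq> 0"
  shows "torus_act sc n K v t N \<in> quiver_grassmannian sc n V f e"
proof -
  have "N \<in> prod_grassmannian sc n V e" using N unfolding quiver_grassmannian_def by blast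
  then obtain S b where S: "S \<in> families" and b: "upper S b" "N = fam S b" using echelon_exists by blast
  have comp: "compatible S" using compatible_if_subrep[OF S b(1)] N b(2) by simp
  have "relations S b" using subrep_iff_relations[OF S b(1) comp] N b(2) by simp
  then show ?thesis
    unfolding b(2) torus_act_fam[OF S t] subrep_iff_relations[OF S upper_twist[OF b(1)] comp]
    using t by (rule relations_twist)
qed

lemma point_fixed:
  assumes S: "S \<in> families" and comp: "compatible S"
  shows "point S \<in> torus_fixed sc n V f K v e"
proof -
  have up: "upper S (\<lambda>i k l. 0)" unfolding upper_def by simp
  have "relations S (\<lambda>i k l. 0)" unfolding relations_def by simp
  then have "point S \<in> quiver_grassmannian sc n V f e"
    unfolding point_def using subrep_iff_relations[OF S up comp] by simp
  moreover have "twist t (\<lambda>i k l. 0) = (\<lambda>i k l. 0)" for t by (intro ext) (simp add: twist_def)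
  ultimately show ?thesis
    unfolding torus_fixed_def point_def using torus_act_fam[OF S] by simp
qed

lemma fixed_imp_point:
  assumes L: "L \<in> torus_fixed sc n V f K v e"
  shows "\<exists>S\<in>families. compatible S \<and> L = point S"
proof -
  \<comment> \<open>One torus element of infinite order is enough, since
    \<open>2 ^ l = 2 ^ k\<close> forces \<open>l = k\<close>.\<close>
  have X: "L \<in> quiver_grassmannian sc n V f e" and fixed: "torus_act sc n K v 2 L = L"
    using L unfolding torus_fixed_def by auto
  then have "L \<in> prod_grassmannian sc n V e" unfolding quiver_grassmannian_def by blast
  then obtain S b where S: "S \<in> families" and b: "upper S b" "L = fam S b" using echelon_exists by blast
  have "compatible S" using compatible_if_subrep[OF S b(1)] X b(2) by simp
  moreover have "L = point S"
    unfolding b(2) point_def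
  proof (rule fam_cong)
    fix i k l assume ikl: "i \<in> {1..n}" "k \<in> S i" "l \<in> K i - S i"
    have "fam S (twist 2 b) = fam S b" using fixed torus_act_fam[OF S, of 2 b] b(2) by simp
    from fam_inject[OF this S ikl] have eq: "2 ^ l / 2 ^ k * b i k l = b i k l" by (simp add: twist_def)
    show "b i k l = 0"
    proof (rule ccontr)
      assume nz: "b i k l \<noteq> 0"
      then have "k < l" using b(1) unfolding upper_def entry_def by blast
      moreover have "(2::complex) ^ l = 2 ^ k" using eq nz by (simp add: field_simps)
      then have "norm ((2::complex) ^ l) = norm ((2::complex) ^ k)" by simp
      then have "(2::real) ^ l = 2 ^ k" by (simp add: norm_power)
      ultimately show False by simp
    qed
  qed
  ultimately show ?thesis using S by blast
qed

section \<open>Limits in the classical topology\<close>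

lemma topspace_grass_classical: "topspace (grass_classical sc n V K v e) = prod_grassmannian sc n V e"
proof -
  let ?T = "grass_classical sc n V K v e"
  have op: "openin ?T W \<longleftrightarrow> W \<subseteq> prod_grassmannian sc n V e \<and>
      openin (top_of_set (frames sc n V K v e)) {A \<in> frames sc n V K v e. frame_span sc n K v e A \<in> W}" for W
    unfolding grass_classical_def openin_quotient_topology by simp
  have "{A \<in> frames sc n V K v e. frame_span sc n K v e A \<in> prod_grassmannian sc n V e} = frames sc n V K v e"
    using framesD by auto
  then have "openin ?T (prod_grassmannian sc n V e)" unfolding op by simp
  then show ?thesis using op by (meson openin_subset openin_topspace subset_antisym)
qed

lemma topspace_grass_zariski: "topspace (grass_zariski sc n V K v e) = prod_grassmannian sc n V e"
proof -
  let ?T = "grass_zariski sc n V K v e"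
  have op: "openin ?T W \<longleftrightarrow> W \<subseteq> prod_grassmannian sc n V e \<and>
      openin (zariski (frames sc n V K v e)) {A \<in> frames sc n V K v e. frame_span sc n K v e A \<in> W}" for W
    unfolding grass_zariski_def openin_quotient_topology by simp
  have "{A \<in> frames sc n V K v e. frame_span sc n K v e A \<in> prod_grassmannian sc n V e}
      = topspace (zariski (frames sc n V K v e))"
    using framesD by auto
  then have "openin ?T (prod_grassmannian sc n V e)" unfolding op by (simp only: openin_topspace subset_refl)
  then show ?thesis using op by (meson openin_subset openin_topspace subset_antisym)
qed

text \<open>The orbit lifts to a continuous path of frames that extends over 0, and convergence
  descends along the quotient map.\<close>

lemma cell_limit:
  assumes S: "S \<in> families" and comp: "compatible S" and N: "N \<in> cell S"
  shows "limitin (subtopology (grass_classical sc n V K v e) (quiver_grassmannian sc n V f e))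
          (\<lambda>t. torus_act sc n K v t N) (point S) (at 0)"
proof -
  let ?X = "quiver_grassmannian sc n V f e" and ?F = "frames sc n V K v e" and ?\<pi> = "frame_span sc n K v e"
  obtain b where b: "upper S b" "N = fam S b" and NX: "N \<in> ?X" using N unfolding cell_def by auto
  have pX: "point S \<in> ?X" using point_fixed[OF S comp] unfolding torus_fixed_def by blast
  \<comment> \<open>Nonzero entries have \<open>k < l\<close>, so the natural subtraction is exact
    and the exponent positive; at 0 only the pivots remain.\<close>
  define g where "g t = frame_mat S (\<lambda>i k l. t ^ (l - k) * b i k l)" for t
  have "continuous_on UNIV (\<lambda>t. g t j)" for j
  proof -
    obtain i c k where j: "j = (i, c, k)" by (cases j) auto
    show ?thesis unfolding g_def frame_mat_def j
      by (cases "i \<in> {1..n} \<and> c < e i \<and> k \<in> K i"; cases "k \<in> S i") (auto intro!: continuous_intros)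
  qed
  then have cont: "continuous_on UNIV g" by (rule continuous_on_coordinatewise_then_product)
  have g0: "?\<pi> (g 0) = point S"
  proof -
    have "(\<lambda>i k l. 0 ^ (l - k) * b i k l) = (\<lambda>i k l. 0)"
    proof (intro ext)
      fix i k l
      show "0 ^ (l - k) * b i k l = 0"
        using b(1) unfolding upper_def entry_def by (cases "b i k l = 0") auto
    qed
    then show ?thesis unfolding g_def frame_mat(2)[OF S] point_def by simp
  qed
  have gt: "?\<pi> (g t) = torus_act sc n K v t N" if t: "t \<noteq> 0" for t
  proof -
    have "(\<lambda>i k l. t ^ (l - k) * b i k l) = twist t b"
    proof (intro ext)
      fix i k l
      show "t ^ (l - k) * b i k l = twist t b i k l"
      proof (cases "b i k l = 0")
        case False
        then have "k < l" using b(1) unfolding upper_def entry_def by blast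
        then show ?thesis using t by (simp add: twist_def power_diff)
      qed (simp add: twist_def)
    qed
    then show ?thesis unfolding g_def frame_mat(2)[OF S] b(2) torus_act_fam[OF S t] by simp
  qed
  show ?thesis
    unfolding limitin_def
  proof (intro conjI allI impI)
    show "point S \<in> topspace (subtopology (grass_classical sc n V K v e) ?X)"
      using pX unfolding topspace_subtopology topspace_grass_classical quiver_grassmannian_def by blast
    fix U assume U: "openin (subtopology (grass_classical sc n V K v e) ?X) U \<and> point S \<in> U"
    then obtain W where W: "openin (grass_classical sc n V K v e) W" "U = W \<inter> ?X"
      unfolding openin_subtopology by blast
    obtain T where T: "open T" "{A \<in> ?F. ?\<pi> A \<in> W} = ?F \<inter> T"
      using W(1) unfolding grass_classical_def openin_quotient_topology openin_open by auto
    have gF: "g t \<in> ?F" for t unfolding g_def by (rule frame_mat(1)[OF S])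
    have gW: "?\<pi> (g t) \<in> W \<longleftrightarrow> g t \<in> T" for t using T(2) gF[of t] by blast
    have "open (g -` T)" using cont T(1) by (rule open_vimage[rotated])
    moreover have "0 \<in> g -` T" using gW[of 0] g0 U W(2) by simp
    moreover have "torus_act sc n K v t N \<in> U" if "t \<in> g -` T" "t \<noteq> 0" for t
      using that gW[of t] gt[of t] torus_act_quiver_grassmannian[OF NX] W(2) by simp
    ultimately show "\<forall>\<^sub>F t in at 0. torus_act sc n K v t N \<in> U"
      unfolding eventually_at_topological by blast
  qed
qed

text \<open>A classical neighbourhood of \<open>point S\<close> inside its chart; its role is to
  bound the matrix entries along an orbit that converges to \<open>point S\<close>.\<close>

definition near :: "(nat \<Rightarrow> nat set) \<Rightarrow> (nat \<Rightarrow> 'v set) set" where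
  "near S = {fam S b | b. \<forall>i\<in>{1..n}. \<forall>k\<in>S i. \<forall>l\<in>K i - S i. norm (b i k l) < 1}"

text \<open>With denominators cleared, the bounds become finitely many strict inequalities between
  norms of polynomials in the frame.\<close>

lemma openin_near:
  assumes S: "S \<in> families"
  shows "openin (grass_classical sc n V K v e) (near S)"
proof -
  let ?F = "frames sc n V K v e" and ?\<pi> = "frame_span sc n K v e"
  let ?T = "\<Inter>i\<in>{1..n}. {A. frame_minor S A i \<noteq> 0} \<inter>
     (\<Inter>k\<in>S i. \<Inter>l\<in>K i - S i. {A. norm (frame_num S A i k l) < norm (frame_minor S A i)})"
  have "?\<pi> A \<in> near S \<longleftrightarrow> A \<in> ?T" if A: "A \<in> ?F" for A
  proof
    assume "?\<pi> A \<in> near S"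
    then obtain b where b: "?\<pi> A = fam S b" "\<forall>i\<in>{1..n}. \<forall>k\<in>S i. \<forall>l\<in>K i - S i. norm (b i k l) < 1"
      unfolding near_def by blast
    have "norm (frame_num S A i k l) < norm (frame_minor S A i)"
      if ikl: "i \<in> {1..n}" "k \<in> S i" "l \<in> K i - S i" for i k l
    proof -
      have nz: "frame_minor S A i \<noteq> 0" by (rule frame_minor_nonzero[OF S A ikl(1) b(1)])
      have "norm (frame_num S A i k l / frame_minor S A i) < 1"
        unfolding coeff_frame[OF S A b(1) ikl] using b(2) ikl by blast
      then show ?thesis using nz by (simp add: norm_divide)
    qed
    then show "A \<in> ?T" using frame_minor_nonzero[OF S A _ b(1)] by blast
  next
    assume T: "A \<in> ?T"
    then have nz: "frame_minor S A i \<noteq> 0" if "i \<in> {1..n}" for i using that by blast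
    have "norm (frame_num S A i k l / frame_minor S A i) < 1"
      if ikl: "i \<in> {1..n}" "k \<in> S i" "l \<in> K i - S i" for i k l
    proof -
      have "norm (frame_num S A i k l) < norm (frame_minor S A i)" using T ikl by blast
      then show ?thesis using nz[OF ikl(1)] by (simp add: norm_divide)
    qed
    then have "\<forall>i\<in>{1..n}. \<forall>k\<in>S i. \<forall>l\<in>K i - S i. norm (frame_num S A i k l / frame_minor S A i) < 1"
      by (intro ballI)
    then show "?\<pi> A \<in> near S"
      unfolding near_def mem_Collect_eq
      by (intro exI[of _ "\<lambda>i k l. frame_num S A i k l / frame_minor S A i"] conjI frame_span_chart[OF S A nz])
  qed
  then have pre: "{A \<in> ?F. ?\<pi> A \<in> near S} = ?F \<inter> ?T" by blast
  have fin: "finite (S i)" "finite (K i - S i)" if "i \<in> {1..n}" for i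
    using finite_K[OF that] families_subset[OF S that] finite_subset by auto
  have "open ?T"
  proof (intro open_INT ballI open_Int)
    fix i assume i: "i \<in> {1..n}"
    have cm: "continuous_on UNIV (\<lambda>A. frame_minor S A i)"
      by (rule continuous_on_polyfun[OF polyfun_frame_minor[OF i]])
    show "open {A. frame_minor S A i \<noteq> 0}"
      using cm by (intro open_Collect_neq continuous_intros)
    show "finite (S i)" "finite (K i - S i)" using fin[OF i] by auto
    fix k l
    show "open {A. norm (frame_num S A i k l) < norm (frame_minor S A i)}"
      using cm continuous_on_polyfun[OF polyfun_frame_num[OF i]]
      by (intro open_Collect_less continuous_on_norm)
  qed simp
  then have "openin (top_of_set ?F) {A \<in> ?F. ?\<pi> A \<in> near S}"
    unfolding pre by (rule openin_open_Int)
  moreover have "near S \<subseteq> prod_grassmannian sc n V e" unfolding near_def using fam_in_prod[OF S] by blast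
  ultimately show ?thesis
    unfolding grass_classical_def openin_quotient_topology by simp
qed

text \<open>A coefficient below the diagonal is multiplied by a negative power of \<open>t\<close>, so it cannot stay
  bounded as \<open>t\<close> tends to \<open>0\<close> unless it vanishes.\<close>

lemma limit_imp_cell:
  assumes S: "S \<in> families" and comp: "compatible S" and NX: "N \<in> quiver_grassmannian sc n V f e"
    and lim: "limitin (subtopology (grass_classical sc n V K v e) (quiver_grassmannian sc n V f e))
          (\<lambda>t. torus_act sc n K v t N) (point S) (at 0)"
  shows "N \<in> cell S"
proof -
  let ?X = "quiver_grassmannian sc n V f e"
  have NP: "N \<in> prod_grassmannian sc n V e" using NX unfolding quiver_grassmannian_def by blast
  have "openin (subtopology (grass_classical sc n V K v e) ?X) (near S \<inter> ?X)"
    using openin_near[OF S] by (rule openin_subtopology_Int)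
  moreover have "point S \<in> near S \<inter> ?X"
    using point_fixed[OF S comp] unfolding torus_fixed_def near_def point_def by auto
  ultimately have ev: "\<forall>\<^sub>F t in at 0. torus_act sc n K v t N \<in> near S"
    using lim unfolding limitin_def by (auto elim: eventually_mono)
  have ev0: "\<forall>\<^sub>F t in at 0. t \<noteq> (0::complex)" by (simp add: eventually_at_filter)
  \<comment> \<open>One torus translate in the chart puts \<open>N\<close> itself there, since
    acting by \<open>1 / s\<close> preserves graphs over \<open>S\<close>.\<close>
  obtain s where s: "torus_act sc n K v s N \<in> near S" "s \<noteq> 0"
    using eventually_happens'[OF _ eventually_conj[OF ev ev0]] by auto
  then obtain c where c: "torus_act sc n K v s N = fam S c" unfolding near_def by blast
  define b where "b = twist (1 / s) c"
  have N: "N = fam S b"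
    using torus_act_inverse[OF NP s(2)] torus_act_fam[OF S, of "1 / s" c] s(2) unfolding c b_def by simp
  have low: "b i k l = 0" if ikl: "i \<in> {1..n}" "k \<in> S i" "l \<in> K i - S i" "\<not> k < l" for i k l
  proof (rule ccontr)
    assume nz: "b i k l \<noteq> 0"
    have lk: "l < k" using ikl by (cases "l = k") auto
    \<comment> \<open>These bounds lead to \<open>norm (b i k l) < norm t ^ (k - l) \<le> norm t <
      norm (b i k l)\<close>, where the middle step uses \<open>norm t < 1\<close>.\<close>
    have ev1: "\<forall>\<^sub>F t in at (0::complex). norm t < min 1 (norm (b i k l))"
      unfolding eventually_at by (rule exI[of _ "min 1 (norm (b i k l))"]) (use nz in auto)
    obtain t where t: "torus_act sc n K v t N \<in> near S" "t \<noteq> 0" "norm t < min 1 (norm (b i k l))"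
      using eventually_happens'[OF _ eventually_conj[OF ev eventually_conj[OF ev0 ev1]]] by auto
    obtain b' where b': "fam S (twist t b) = fam S b'"
       "\<forall>i\<in>{1..n}. \<forall>k\<in>S i. \<forall>l\<in>K i - S i. norm (b' i k l) < 1"
      using t(1) unfolding N torus_act_fam[OF S t(2)] near_def by blast
    have "norm (twist t b i k l) < 1"
      unfolding fam_inject[OF b'(1) S ikl(1-3)] using b'(2) ikl by blast
    then have "norm t ^ l / norm t ^ k * norm (b i k l) < 1"
      by (simp add: twist_def norm_mult norm_divide norm_power)
    then have "norm (b i k l) < norm t ^ (k - l)"
      using t(2) lk by (simp add: power_diff field_simps)
    also have "\<dots> \<le> norm t ^ 1" using t(3) lk by (intro power_decreasing) auto
    finally show False using t(3) by simp
  qed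
  define b' where "b' i k l = (if entry S i k l then b i k l else 0)" for i k l
  have "upper S b'" unfolding upper_def b'_def by simp
  moreover have "N = fam S b'"
    unfolding N by (rule fam_cong) (use low in \<open>auto simp: b'_def entry_def\<close>)
  ultimately show ?thesis using NX unfolding cell_def by blast
qed

lemma attracting_set_point:
  assumes "S \<in> families" "compatible S"
  shows "attracting_set sc n V f K v e (point S) = cell S"
  using cell_limit[OF assms] limit_imp_cell[OF assms] unfolding attracting_set_def cell_def by blast

subsection \<open>The order of the cells\<close>

definition weight :: "(nat \<Rightarrow> nat set) \<Rightarrow> nat" where
  "weight S = (\<Sum>i\<in>{1..n}. \<Sum>k\<in>S i. 2 ^ k)"

text \<open>Where the pivots differ, \<open>echelon_weight\<close> gives a strict inequality; at the
  other vertices the summands are equal, and at least one vertex is of the first kind.\<close>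

lemma chart_weight:
  assumes S: "S \<in> families" and S': "S' \<in> families" and up: "upper S' b" and ch: "fam S' b \<in> chart S"
    and ne: "S \<noteq> S'"
  shows "weight S' < weight S"
proof -
  obtain c where c: "fam S' b = fam S c" using ch unfolding chart_def by auto
  have less: "(\<Sum>k\<in>S' i. 2 ^ k) < (\<Sum>k\<in>S i. 2 ^ k :: nat)" if i: "i \<in> {1..n}" "S i \<noteq> S' i" for i
  proof -
    interpret ns: numbered_space sc "K i" "v i" using i(1) by (rule space)
    have "ns.graph (S' i) (b i) = ns.graph (S i) (c i)"
      using fun_cong[OF c, of i] unfolding fam_apply[OF i(1)] .
    then have "ns.in_chart (S i) (ns.graph (S' i) (b i))" using ns.in_chart_graph by simp
    moreover have "k < l" if "b i k l \<noteq> 0" for k l using that up unfolding upper_def entry_def by blast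
    ultimately show ?thesis
      using families_subset[OF S i(1)] families_subset[OF S' i(1)] i(2) by (intro ns.echelon_weight[of "S i" "S' i" "b i"])
  qed
  have "\<exists>i\<in>{1..n}. S i \<noteq> S' i"
  proof (rule ccontr)
    assume "\<not> ?thesis"
    then have "S i = S' i" if "i \<in> {1..n}" for i using that by blast
    then have "S = S'" using S S' unfolding families_def by (rule PiE_ext[rotated 2])
    then show False using ne by contradiction
  qed
  then have "\<exists>i\<in>{1..n}. (\<Sum>k\<in>S' i. 2 ^ k) < (\<Sum>k\<in>S i. 2 ^ k :: nat)" using less by blast
  moreover have "\<forall>i\<in>{1..n}. (\<Sum>k\<in>S' i. 2 ^ k) \<le> (\<Sum>k\<in>S i. 2 ^ k :: nat)" using less by (metis eq_refl less_imp_le)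
  ultimately show ?thesis unfolding weight_def by (intro sum_strict_mono_ex1) auto
qed

text \<open>A common point lies in both charts, so with different pivots each weight would be
  smaller than the other.\<close>

lemma cell_unique:
  assumes "S \<in> families" "S' \<in> families" "N \<in> cell S" "N \<in> cell S'"
  shows "S = S'"
proof (rule ccontr)
  assume ne: "S \<noteq> S'"
  obtain b where b: "upper S b" "N = fam S b" using assms(3) unfolding cell_def by auto
  obtain b' where b': "upper S' b'" "N = fam S' b'" using assms(4) unfolding cell_def by auto
  have "fam S b \<in> chart S'" "fam S' b' \<in> chart S"
    unfolding chart_def using rangeI[of "fam S" b] rangeI[of "fam S'" b'] b(2) b'(2) by argo+
  then show False
    using chart_weight[OF assms(1,2) b'(1) _ ne] chart_weight[OF assms(2,1) b(1) _ ne[symmetric]] by auto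
qed

lemma exists_cell:
  assumes N: "N \<in> quiver_grassmannian sc n V f e"
  shows "\<exists>S\<in>families. compatible S \<and> N \<in> cell S"
proof -
  have "N \<in> prod_grassmannian sc n V e" using N unfolding quiver_grassmannian_def by blast
  then obtain S b where S: "S \<in> families" and b: "upper S b" "N = fam S b" using echelon_exists by blast
  have "compatible S" using compatible_if_subrep[OF S b(1)] N b(2) by simp
  moreover have "N \<in> cell S" unfolding cell_def using b N by blast
  ultimately show ?thesis using S by blast
qed

lemma point_in_cell: "S \<in> families \<Longrightarrow> compatible S \<Longrightarrow> point S \<in> cell S"
  using point_fixed[of S] unfolding cell_def torus_fixed_def point_def upper_def by auto

text \<open>The chart of \<open>S\<close> meets, apart from the cell of \<open>S\<close>, only cells
  of strictly smaller weight. It is therefore a neighbourhood that avoids \<open>I\<close> whenever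
  \<open>S\<close> is outside \<open>I\<close>.\<close>

lemma closedin_cells:
  assumes I: "I \<subseteq> {S \<in> families. compatible S}"
    and order: "\<And>S S'. S \<in> families \<Longrightarrow> compatible S \<Longrightarrow> S \<notin> I \<Longrightarrow> S' \<in> I \<Longrightarrow> weight S \<le> weight S'"
  shows "closedin (subtopology (grass_zariski sc n V K v e) (quiver_grassmannian sc n V f e)) (\<Union>S\<in>I. cell S)"
proof -
  let ?X = "quiver_grassmannian sc n V f e"
  let ?T = "subtopology (grass_zariski sc n V K v e) ?X"
  have top: "topspace ?T = ?X"
    unfolding topspace_subtopology topspace_grass_zariski quiver_grassmannian_def by blast
  have "\<exists>U. openin ?T U \<and> N \<in> U \<and> U \<subseteq> ?X - (\<Union>S\<in>I. cell S)" if N: "N \<in> ?X - (\<Union>S\<in>I. cell S)" for N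
  proof -
    obtain S where S: "S \<in> families" "compatible S" "N \<in> cell S" using exists_cell N by blast
    have SI: "S \<notin> I" using N S(3) by blast
    have "openin ?T (chart S \<inter> ?X)" using openin_chart[OF S(1)] by (rule openin_subtopology_Int)
    moreover have "N \<in> chart S \<inter> ?X" using S(3) unfolding cell_def chart_def by auto
    moreover have "N' \<notin> cell S'" if N': "N' \<in> chart S" and S': "S' \<in> I" for N' S'
    proof
      assume "N' \<in> cell S'"
      then obtain b where b: "upper S' b" "N' = fam S' b" unfolding cell_def by auto
      have "S \<noteq> S'" using SI S' by blast
      then have "weight S' < weight S"
        using chart_weight[OF S(1) _ b(1)] N' b(2) I S' by blast
      then show False using order[OF S(1,2) SI S'] by simp
    qed
    ultimately show ?thesis by (intro exI[of _ "chart S \<inter> ?X"]) blast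
  qed
  then have "openin ?T (?X - (\<Union>S\<in>I. cell S))" by (subst openin_subopen) blast
  moreover have "(\<Union>S\<in>I. cell S) \<subseteq> ?X" unfolding cell_def by blast
  ultimately show ?thesis unfolding closedin_def top by blast
qed

section \<open>Assembly of the cellular decomposition\<close>

lemma cellular_decomposition_attracting:
  "cellular_decomposition sc n V K v e (quiver_grassmannian sc n V f e)
     (torus_fixed sc n V f K v e) (attracting_set sc n V f K v e)"
proof -
  let ?X = "quiver_grassmannian sc n V f e" and ?C = "attracting_set sc n V f K v e"
  define J where "J = {S \<in> families. compatible S}"
  have fixed: "torus_fixed sc n V f K v e = point ` J"
  proof
    show "torus_fixed sc n V f K v e \<subseteq> point ` J"
      unfolding J_def using fixed_imp_point by fastforce
    show "point ` J \<subseteq> torus_fixed sc n V f K v e"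
      unfolding J_def using point_fixed by auto
  qed
  have att: "?C (point S) = cell S" if "S \<in> J" for S
    using that attracting_set_point unfolding J_def by blast
  have inj: "inj_on point J"
  proof (rule inj_onI)
    fix S S' assume SS': "S \<in> J" "S' \<in> J" "point S = point S'"
    then have "point S \<in> cell S" "point S \<in> cell S'"
      using point_in_cell[of S] point_in_cell[of S'] unfolding J_def by auto
    then show "S = S'" using cell_unique[of S S'] SS' unfolding J_def by simp
  qed
  have "?X = (\<Union>S\<in>J. cell S)"
  proof
    show "?X \<subseteq> (\<Union>S\<in>J. cell S)" using exists_cell unfolding J_def by auto
    show "(\<Union>S\<in>J. cell S) \<subseteq> ?X" unfolding cell_def by auto
  qed
  then have union: "?X = (\<Union>L\<in>torus_fixed sc n V f K v e. ?C L)"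
    unfolding fixed using att by simp
  have disj: "disjoint_family_on ?C (torus_fixed sc n V f K v e)"
    unfolding disjoint_family_on_def
  proof (intro ballI impI)
    fix L L' assume "L \<in> torus_fixed sc n V f K v e" "L' \<in> torus_fixed sc n V f K v e" "L \<noteq> L'"
    then obtain S S' where S: "S \<in> J" "L = point S" "S' \<in> J" "L' = point S'" "S \<noteq> S'"
      unfolding fixed by (metis imageE)
    then have "cell S \<inter> cell S' = {}" using cell_unique[of S S'] unfolding J_def by auto
    then show "?C L \<inter> ?C L' = {}" using att S by simp
  qed
  have affine: "\<forall>L\<in>torus_fixed sc n V f K v e. is_affine_cell sc n V K v e (?C L)"
    unfolding fixed
  proof
    fix L assume "L \<in> point ` J"
    then obtain S where S: "S \<in> J" "L = point S" by blast
    then show "is_affine_cell sc n V K v e (?C L)"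
      unfolding S(2) att[OF S(1)] J_def by (intro is_affine_cell_cell) auto
  qed
  have "finite J" unfolding J_def using finite_families by simp
  then obtain xs where xs: "distinct xs" "set xs = J" using finite_distinct_list by blast
  \<comment> \<open>Sorting is ascending and closed unions need the heaviest cells to come first,
    hence the reversal; cells of equal weight may come in any order.\<close>
  define ls where "ls = rev (sort_key weight xs)"
  have ls: "distinct ls" "set ls = J" unfolding ls_def using xs by auto
  have sorted: "sorted_wrt (\<lambda>S S'. weight S' \<le> weight S) ls"
    using sorted_sort_key[of weight xs] unfolding ls_def sorted_wrt_rev by (simp add: sorted_map)
  have closed: "closedin (subtopology (grass_zariski sc n V K v e) ?X) (\<Union>L\<in>set (take m (map point ls)). ?C L)" for m
  proof -
    have sub: "set (take m ls) \<subseteq> J" using ls(2) set_take_subset[of m ls] by simp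
    have "closedin (subtopology (grass_zariski sc n V K v e) ?X) (\<Union>S\<in>set (take m ls). cell S)"
    proof (rule closedin_cells)
      show "set (take m ls) \<subseteq> {S \<in> families. compatible S}" using sub unfolding J_def .
      fix S S' assume S: "S \<in> families" "compatible S" "S \<notin> set (take m ls)" "S' \<in> set (take m ls)"
      have split: "take m ls @ drop m ls = ls" by simp
      have "S \<in> set ls" using S ls(2) unfolding J_def by blast
      moreover have "set ls = set (take m ls) \<union> set (drop m ls)"
        using arg_cong[OF split, of set] unfolding set_append by (rule sym)
      ultimately have "S \<in> set (drop m ls)" using S(3) by blast
      moreover have "sorted_wrt (\<lambda>S S'. weight S' \<le> weight S) (take m ls @ drop m ls)"
        using sorted unfolding split .
      ultimately show "weight S \<le> weight S'" using S(4) unfolding sorted_wrt_append by auto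
    qed
    moreover have "(\<Union>L\<in>set (take m (map point ls)). ?C L) = (\<Union>S\<in>set (take m ls). cell S)"
      using sub att by (auto simp: take_map)
    ultimately show ?thesis by simp
  qed
  have "distinct (map point ls) \<and> set (map point ls) = torus_fixed sc n V f K v e"
    unfolding fixed distinct_map using ls inj by simp
  then show ?thesis
    unfolding cellular_decomposition_def
    by (intro conjI exI[of _ "map point ls"] allI impI union disj affine closed) (elim conjE, assumption)+
qed

end

theorem theorem12:
  fixes sc :: "complex \<Rightarrow> 'v::ab_group_add \<Rightarrow> 'v"
    and n :: nat
    and V :: "nat \<Rightarrow> 'v set"
    and f :: "nat \<Rightarrow> 'v \<Rightarrow> 'v"
    and K :: "nat \<Rightarrow> nat set"
    and v :: "nat \<Rightarrow> nat \<Rightarrow> 'v"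
    and e :: "nat \<Rightarrow> nat"
  assumes "vector_space sc"
    and "1 \<le> n"
    and "quiver_rep sc n V f"
    and "numbered_basis sc n V f K v"
  shows "(\<forall>L \<in> torus_fixed sc n V f K v e.
            is_affine_cell sc n V K v e (attracting_set sc n V f K v e L)) \<and>
         cellular_decomposition sc n V K v e (quiver_grassmannian sc n V f e)
            (torus_fixed sc n V f K v e) (attracting_set sc n V f K v e)"
proof -
  interpret vector_space sc by (rule assms(1))
  interpret numbered_rep sc n V f K v e
    using assms(3,4) by unfold_locales
  have "\<forall>L \<in> torus_fixed sc n V f K v e.
      is_affine_cell sc n V K v e (attracting_set sc n V f K v e L)"
    using cellular_decomposition_attracting unfolding cellular_decomposition_def by (elim conjE)
  then show ?thesis using cellular_decomposition_attracting by (rule conjI)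
qed

end
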